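(* Let $\alpha>0$ and let $(X,Y)$ follow a bivariate Sarmanov distribution with marginal distribution functions $F$ (of $X$) and $G$ (of $Y$), kernels $\phi_1,\phi_2$ and parameter $\theta\in\mathbb{R}$. Assume $X$ is nonnegative and $X\in RV_{-\alpha}$, and write $\overline F(x)=P[X>x]=x^{-\alpha}L(x)$ with $L$ slowly varying. Assume also that $E[Y^{\alpha}]<\infty$, that $P[Y>x]=o(P[X>x])$ as $x\to\infty$, and that $\lim_{x\to\infty}\phi_1(x)=d_1$ exists (in $\mathbb{R}$). If any one of the three conditions (DZ2), (DZ3), (DZ4) (see context) holds for $(X,Y)$, then, as $x\to\infty$, $$P[XY>x]\sim \left[E(Y^{\alpha})+\theta d_1 E\{\phi_2(Y)Y^{\alpha}\}\right]\overline F(x).$$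
   Context: Asymptotics: $a(x)\sim b(x)$ means $a(x)/b(x)\to1$ as $x\to\infty$. Regular variation: $X\in RV_{-\alpha}$ means $\overline F(xy)\sim y^{-\alpha}\overline F(x)$ as $x\to\infty$ for every $y>0$, where $\overline F(x)=P[X>x]$. Bivariate Sarmanov distribution: $(X,Y)$ with $X$ real valued and $Y\ge 0$ follows a bivariate Sarmanov distribution if $P(X\in dx,Y\in dy)=(1+\theta\phi_1(x)\phi_2(y))F(dx)G(dy)$, $x\in\mathbb{R}$, $y\ge0$, where $F,G$ are the marginal distributions of $X,Y$, the kernels $\phi_1,\phi_2$ are real-valued functions and $\theta$ is a real constant such that $E\{\phi_1(X)\}=E\{\phi_2(Y)\}=0$ and $1+\theta\phi_1(x)\phi_2(y)\ge0$ for all $x\in D_X$, $y\in D_Y$, where $D_X\subset\mathbb{R}$ and $D_Y\subset\mathbb{R}^+$ are the supports of $X$ and $Y$. Long-tailed: a random variable $U$ is long tailed if $P[U>x]\sim P[U>x+y]$ as $x\to\infty$ for any $y$. Class $\mathcal S_d$: a nonnegative function $f$ is in $\mathcal S_d$ if $\lim_{x\to\infty}\int_0^x \frac{f(x-y)}{f(x)}f(y)\,dy=2\int_0^\infty f(u)\,du<\infty$. Write $U\in\mathcal S^*$ if $f(x)=P[U>x]$ is in $\mathcal S_d$. Types of $L(x)=x^{\alpha}\overline F(x)$: $L$ is of type (iii) if $L(x)=c(x)P(U>\log x)$, and of type (iv) if $L(x)=c(x)P(U>\log x)/P(V>\log x)$, where $U,V$ are long-tailed random variables and $\lim_{x\to\infty}c(x)=c\in(0,\infty)$.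 The conditions: (DZ2) $L$ is of type (iii) or (iv), and the function $x\mapsto L(e^x)$ is in $\mathcal S_d$. (DZ3) $L$ is of type (iii) or (iv), $U\in\mathcal S^*$ (with $U$ from that representation), and $P(Y>x)=o(x^{-\alpha}P[U>\log x])$. (DZ4) $E[X^\alpha]=\infty$, i.e. $m(x):=\int_0^x v^\alpha F(dv)\to\infty$ as $x\to\infty$; moreover $P(Y>x)=o(P[X>x]/m(x))$ and $\limsup_{x\to\infty}\sup_{\sqrt x\le y\le x}L(y)/L(x)<\infty$. *)

theory Defs
  imports "HOL-Probability.Probability" "HOL-Library.Landau_Symbols"
begin

text \<open>
  The relation \<open>a(x) \<sim> b(x)\<close> as \<open>x \<rightarrow> \<infinity>\<close>. Unlike the library's \<^const>\<open>asymp_equiv\<close>,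
  which reads \<open>0 / 0\<close> as \<open>1\<close>, this forces \<open>a\<close> and \<open>b\<close> to be nonzero eventually; hence
  regularly varying and long-tailed distributions below have unbounded support.
\<close>

definition tail_equiv :: "(real \<Rightarrow> real) \<Rightarrow> (real \<Rightarrow> real) \<Rightarrow> bool" where
  "tail_equiv a b \<longleftrightarrow> ((\<lambda>x. a x / b x) \<longlongrightarrow> 1) at_top"

definition tail :: "'a measure \<Rightarrow> ('a \<Rightarrow> real) \<Rightarrow> real \<Rightarrow> real" where
  "tail M X x = \<P>(\<omega> in M. X \<omega> > x)"

text \<open>\<open>X \<in> RV\<^bsub>-\<alpha>\<^esub>\<close>; the argument is \<open>\<alpha>\<close>, not the index \<open>-\<alpha>\<close>.\<close>

definition regularly_varying :: "'a measure \<Rightarrow> ('a \<Rightarrow> real) \<Rightarrow> real \<Rightarrow> bool" where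
  "regularly_varying M X \<alpha> \<longleftrightarrow>
     (\<forall>y>0. tail_equiv (\<lambda>x. tail M X (x * y)) (\<lambda>x. y powr (-\<alpha>) * tail M X x))"

text \<open>The function \<open>L\<close> with \<open>P[X > x] = x\<^bsup>-\<alpha>\<^esup> L(x)\<close> for \<open>x > 0\<close>.\<close>

definition slow_part :: "'a measure \<Rightarrow> ('a \<Rightarrow> real) \<Rightarrow> real \<Rightarrow> real \<Rightarrow> real" where
  "slow_part M X \<alpha> x = x powr \<alpha> * tail M X x"

definition dist_support :: "real measure \<Rightarrow> real set" where
  "dist_support \<mu> = {x. \<forall>\<delta>>0. measure \<mu> {x - \<delta><..<x + \<delta>} > 0}"

definition sarmanov ::
  "'a measure \<Rightarrow> ('a \<Rightarrow> real) \<Rightarrow> ('a \<Rightarrow> real) \<Rightarrow> (real \<Rightarrow> real) \<Rightarrow> (real \<Rightarrow> real) \<Rightarrow> real \<Rightarrow> bool"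
where
  "sarmanov M X Y \<phi>1 \<phi>2 \<theta> \<longleftrightarrow>
     X \<in> borel_measurable M \<and> Y \<in> borel_measurable M \<and> (AE \<omega> in M. 0 \<le> Y \<omega>) \<and>
     \<phi>1 \<in> borel_measurable borel \<and> \<phi>2 \<in> borel_measurable borel \<and>
     has_bochner_integral M (\<lambda>\<omega>. \<phi>1 (X \<omega>)) 0 \<and>
     has_bochner_integral M (\<lambda>\<omega>. \<phi>2 (Y \<omega>)) 0 \<and>
     (\<forall>x \<in> dist_support (distr M borel X). \<forall>y \<in> dist_support (distr M borel Y).
        0 \<le> 1 + \<theta> * \<phi>1 x * \<phi>2 y) \<and>
     distr M (borel \<Otimes>\<^sub>M borel) (\<lambda>\<omega>. (X \<omega>, Y \<omega>)) =
       density (distr M borel X \<Otimes>\<^sub>M distr M borel Y)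
         (\<lambda>(x, y). ennreal (1 + \<theta> * \<phi>1 x * \<phi>2 y))"

text \<open>
  The auxiliary random variables \<open>U\<close> and \<open>V\<close> enter only through their distributions, so
  they are represented by their laws on the real line.
\<close>

abbreviation surv :: "real measure \<Rightarrow> real \<Rightarrow> real" where
  "surv U \<equiv> tail U (\<lambda>u. u)"

definition long_tailed :: "real measure \<Rightarrow> bool" where
  "long_tailed U \<longleftrightarrow> real_distribution U \<and>
     (\<forall>y. tail_equiv (\<lambda>x. surv U x) (\<lambda>x. surv U (x + y)))"

text \<open>
  Only the values of \<open>f\<close> on \<open>[0, \<infinity>)\<close> matter. Eventual positivity makes the quotient
  meaningful, and measurability makes the integrals meaningful.
\<close>

definition class_Sd :: "(real \<Rightarrow> real) \<Rightarrow> bool" where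
  "class_Sd f \<longleftrightarrow>
     (\<forall>x\<ge>0. 0 \<le> f x) \<and> set_borel_measurable borel {0..} f \<and> (\<forall>\<^sub>F x in at_top. 0 < f x) \<and>
     (\<integral>\<^sup>+u\<in>{0..}. ennreal (f u) \<partial>lborel) < \<infinity> \<and>
     ((\<lambda>x. \<integral>\<^sup>+y\<in>{0..x}. ennreal (f (x - y) / f x * f y) \<partial>lborel)
        \<longlongrightarrow> 2 * (\<integral>\<^sup>+u\<in>{0..}. ennreal (f u) \<partial>lborel)) at_top"

definition class_S_star :: "real measure \<Rightarrow> bool" where
  "class_S_star U \<longleftrightarrow> class_Sd (surv U)"

definition type_iii :: "(real \<Rightarrow> real) \<Rightarrow> real measure \<Rightarrow> bool" where
  "type_iii L U \<longleftrightarrow> long_tailed U \<and>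
     (\<exists>c c0. 0 < c0 \<and> (c \<longlongrightarrow> c0) at_top \<and> (\<forall>x>0. L x = c x * surv U (ln x)))"

definition type_iv :: "(real \<Rightarrow> real) \<Rightarrow> real measure \<Rightarrow> bool" where
  "type_iv L U \<longleftrightarrow> long_tailed U \<and>
     (\<exists>V c c0. long_tailed V \<and> 0 < c0 \<and> (c \<longlongrightarrow> c0) at_top \<and>
        (\<forall>x>0. L x = c x * surv U (ln x) / surv V (ln x)))"

definition DZ2 :: "'a measure \<Rightarrow> ('a \<Rightarrow> real) \<Rightarrow> real \<Rightarrow> bool" where
  "DZ2 M X \<alpha> \<longleftrightarrow>
     (\<exists>U. type_iii (slow_part M X \<alpha>) U \<or> type_iv (slow_part M X \<alpha>) U) \<and>
     class_Sd (\<lambda>x. slow_part M X \<alpha> (exp x))"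

definition DZ3 :: "'a measure \<Rightarrow> ('a \<Rightarrow> real) \<Rightarrow> ('a \<Rightarrow> real) \<Rightarrow> real \<Rightarrow> bool" where
  "DZ3 M X Y \<alpha> \<longleftrightarrow>
     (\<exists>U. (type_iii (slow_part M X \<alpha>) U \<or> type_iv (slow_part M X \<alpha>) U) \<and>
        class_S_star U \<and>
        tail M Y \<in> o[at_top](\<lambda>x. x powr (-\<alpha>) * surv U (ln x)))"

definition trunc_moment :: "'a measure \<Rightarrow> ('a \<Rightarrow> real) \<Rightarrow> real \<Rightarrow> real \<Rightarrow> real" where
  "trunc_moment M X \<alpha> x = (LINT v:{0..x}|distr M borel X. v powr \<alpha>)"

definition DZ4 :: "'a measure \<Rightarrow> ('a \<Rightarrow> real) \<Rightarrow> ('a \<Rightarrow> real) \<Rightarrow> real \<Rightarrow> bool" where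
  "DZ4 M X Y \<alpha> \<longleftrightarrow>
     (\<integral>\<^sup>+\<omega>. ennreal (X \<omega> powr \<alpha>) \<partial>M) = \<infinity> \<and>
     filterlim (trunc_moment M X \<alpha>) at_top at_top \<and>
     tail M Y \<in> o[at_top](\<lambda>x. tail M X x / trunc_moment M X \<alpha> x) \<and>
     Limsup at_top (\<lambda>x. SUP y\<in>{sqrt x..x}.
        ereal (slow_part M X \<alpha> y / slow_part M X \<alpha> x)) < \<infinity>"

end

theory Submission
  imports Defs
begin

text \<open>
  Write \<open>F\<close>, \<open>G\<close> for the laws of \<open>X\<close>, \<open>Y\<close>, and \<open>p(u, v) = 1 + \<theta> \<phi>\<^sub>1(u) \<phi>\<^sub>2(v)\<close> for the density of the
  joint law with respect to \<open>F \<Otimes> G\<close>. For fixed \<open>v > 0\<close> the event \<open>u v > x\<close> forces \<open>u > x / v\<close>, where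
  \<open>\<phi>\<^sub>1(u)\<close> is close to \<open>d\<^sub>1\<close>, so that
  \<open>\<integral> 1(u v > x) p(u, v) F(du) \<sim> (1 + \<theta> d\<^sub>1 \<phi>\<^sub>2(v)) P[X > x / v] \<sim> (1 + \<theta> d\<^sub>1 \<phi>\<^sub>2(v)) v\<^sup>\<alpha> P[X > x]\<close>.
  Integrating over \<open>v\<close> gives the constant of the theorem, so the whole matter is to exchange the limit
  with the integral against \<open>G\<close>.

  Positivity of \<open>p\<close> on the product of the supports, together with the centring of the kernels, makes
  both kernels bounded unless one of them vanishes almost surely (\<open>kernel_bounded_on_support\<close>), in
  which case \<open>p = 1\<close>. Hence \<open>p\<close> is bounded. On \<open>v \<le> N\<close> the exchange is then dominated convergence,
  the majorant being a multiple of \<open>P[X > x / N] / P[X > x]\<close>, which converges; and on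
  \<open>v > N\<close> the contribution is at most a multiple of
  \<open>P[X' Y' > x, Y' > N]\<close> with \<^emph>\<open>independent\<close> \<open>X' \<sim> F\<close> and \<open>Y' \<sim> G\<close>. So it suffices that this probability
  be small compared with \<open>P[X > x]\<close> for \<open>N\<close> large, uniformly in large \<open>x\<close>
  (\<open>perturbed_product_tail\<close>).

  Each of the three conditions gives this negligibility.

  Under the first two, pass to \<open>t = ln x\<close> and integrate by parts: the part of the probability with \<open>Y'\<close>
  below a fixed multiple of \<open>x\<close> is bounded by an integral of \<open>P[X > e\<^bsup>t - s\<^esup>] P[Y > e\<^bsup>s - 1\<^esup>]\<close> over \<open>s\<close>.
  The first factor is at most a multiple of \<open>e\<^bsup>\<alpha> s\<^esup> P[X > x] h(t - s) / h(t)\<close> and the second is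
  \<open>o(e\<^bsup>- \<alpha> s\<^esup> h(s))\<close>, for \<open>h\<close> either \<open>s \<mapsto> L(e\<^sup>s)\<close> or the tail of \<open>U\<close>. The exponentials cancel, and what
  remains is the convolution that the class \<open>\<S>\<^sub>d\<close> bounds
  (\<open>large_factor_negligible_if_class_Sd\<close>).

  Under the third, cut at \<open>\<surd>x\<close>. If \<open>Y' \<le> \<surd>x\<close>, the uniform bound on \<open>L(y) / L(x)\<close> leaves the tail of the
  integral \<open>E[Y\<^sup>\<alpha>]\<close>. If \<open>X' \<le> \<surd>x\<close>, the same bound leaves the truncated moment \<open>m(\<surd>x)\<close>, which cancels
  against the denominator in \<open>P[Y > x] = o(P[X > x] / m(x))\<close>. If both factors exceed \<open>\<surd>x\<close>, use in addition
  \<open>L = O(m)\<close> (\<open>large_factor_negligible_if_infinite_moment\<close>).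
\<close>

section \<open>Survival functions and supports of laws on the real line\<close>

lemma (in prob_space) surv_distr:
  assumes [measurable]: "X \<in> borel_measurable M"
  shows "surv (distr M borel X) = tail M X"
  by (rule ext, unfold tail_def, subst measure_distr) (auto intro!: arg_cong[where f = "measure M"])

context real_distribution
begin

lemma surv_eq_measure: "surv M x = measure M {x<..}"
  by (simp add: tail_def greaterThan_def)

lemma surv_nonneg: "0 \<le> surv M x"
  by (simp add: surv_eq_measure)

lemma surv_antimono: "x \<le> y \<Longrightarrow> surv M y \<le> surv M x"
  unfolding surv_eq_measure by (intro finite_measure_mono) auto

lemma borel_measurable_surv [measurable]: "surv M \<in> borel_measurable borel"
proof -
  have "(\<lambda>x. - surv M x) \<in> borel_measurable borel"
    by (intro borel_measurable_mono monoI) (simp add: surv_antimono)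
  then show ?thesis by simp
qed

lemma integrable_indicator [simp]:
  "A \<in> sets borel \<Longrightarrow> integrable M (indicator A :: real \<Rightarrow> real)"
  by (rule integrable_const_bound[where B = 1]) auto

lemma eventually_surv_pos_imp_pos:
  assumes "\<forall>\<^sub>F x in at_top. surv M x \<noteq> 0"
  shows "0 < surv M x"
proof -
  obtain z where z: "\<And>y. z \<le> y \<Longrightarrow> surv M y \<noteq> 0"
    using assms by (auto simp: eventually_at_top_linorder)
  have "0 < surv M (max x z)"
    using surv_nonneg[of "max x z"] z[of "max x z"] by simp
  also have "\<dots> \<le> surv M x"
    by (intro surv_antimono) simp
  finally show ?thesis .
qed

text \<open>
  The complement of the support is a union of null intervals with rational end points.
\<close>

lemma AE_dist_support: "AE x in M. x \<in> dist_support M"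
proof -
  define I where "I = {(p, q). p \<in> \<rat> \<and> q \<in> \<rat> \<and> measure M {p<..<q} = 0}"
  have "countable (\<rat> \<times> \<rat> :: (real \<times> real) set)"
    by (intro countable_SIGMA countable_rat)
  then have cI: "countable I"
    by (rule countable_subset[rotated]) (auto simp: I_def)
  have "AE x in M. \<forall>i\<in>I. x \<notin> {fst i<..<snd i}"
  proof (subst AE_ball_countable[OF cI], intro ballI)
    fix i assume "i \<in> I"
    then have "prob {fst i<..<snd i} = 0" by (auto simp: I_def)
    then show "AE x in M. x \<notin> {fst i<..<snd i}"
      by (intro AE_not_in) (simp add: null_sets_def emeasure_eq_measure)
  qed
  then show ?thesis
  proof eventually_elim
    case (elim x)
    show ?case
    proof (rule ccontr)
      assume "x \<notin> dist_support M"
      then obtain \<delta> where \<delta>: "0 < \<delta>" "measure M {x - \<delta><..<x + \<delta>} = 0"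
        unfolding dist_support_def using zero_less_measure_iff by blast
      obtain p q where pq: "p \<in> \<rat>" "x - \<delta> < p" "p < x" "q \<in> \<rat>" "x < q" "q < x + \<delta>"
        using Rats_dense_in_real[of "x - \<delta>" x] Rats_dense_in_real[of x "x + \<delta>"] \<delta>(1) by auto
      have "measure M {p<..<q} \<le> measure M {x - \<delta><..<x + \<delta>}"
        using pq by (intro finite_measure_mono) auto
      then have "(p, q) \<in> I"
        using \<delta>(2) pq measure_nonneg[of M "{p<..<q}"] by (simp add: I_def)
      with elim pq show False by force
    qed
  qed
qed

text \<open>
  A function that is nowhere positive on the support has integral \<open>0\<close> only if it vanishes almost surely.
\<close>

lemma ex_dist_support_pos:
  fixes \<psi> :: "real \<Rightarrow> real"
  assumes "has_bochner_integral M \<psi> 0" "\<not> (AE v in M. \<psi> v = 0)"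
  shows "\<exists>v\<in>dist_support M. 0 < \<psi> v"
proof (rule ccontr)
  assume "\<not> ?thesis"
  then have "\<psi> v \<le> 0" if "v \<in> dist_support M" for v
    using that by (meson not_le)
  then have neg: "AE v in M. 0 \<le> - \<psi> v"
    using AE_dist_support by (auto elim!: eventually_mono)
  have int: "integrable M (\<lambda>v. - \<psi> v)" "(LINT v|M. - \<psi> v) = 0"
    using assms(1) by (auto simp: has_bochner_integral_iff)
  have "AE v in M. - \<psi> v = 0"
    using integral_nonneg_eq_0_iff_AE[OF int(1) neg] int(2) by simp
  with assms(2) show False by simp
qed

end

lemma long_tailed_surv_pos:
  assumes "long_tailed U"
  shows "0 < surv U x"
proof (rule real_distribution.eventually_surv_pos_imp_pos)
  show "real_distribution U" using assms by (simp add: long_tailed_def)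
  have "((\<lambda>x. surv U x / surv U (x + 0)) \<longlongrightarrow> 1) at_top"
    using assms by (simp add: long_tailed_def tail_equiv_def del: add_0_right)
  then have "\<forall>\<^sub>F x in at_top. 0 < surv U x / surv U (x + 0)"
    by (rule order_tendstoD) simp
  then show "\<forall>\<^sub>F x in at_top. surv U x \<noteq> 0"
    by eventually_elim auto
qed

text \<open>
  A centred kernel that is not trivial takes both signs on the support, say
  \<open>\<psi> v\<^sub>1 > 0 > \<psi> v\<^sub>2\<close>. Positivity of the density on the lines \<open>v = v\<^sub>1\<close> and \<open>v = v\<^sub>2\<close> then
  bounds the other kernel from below and from above.
\<close>

lemma kernel_bounded_on_support:
  fixes \<phi> \<psi> :: "real \<Rightarrow> real"
  assumes "real_distribution G" "has_bochner_integral G \<psi> 0" "\<not> (AE v in G. \<psi> v = 0)"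
    and nonneg: "\<And>u v. u \<in> D \<Longrightarrow> v \<in> dist_support G \<Longrightarrow> 0 \<le> 1 + \<phi> u * \<psi> v"
  shows "\<exists>C\<ge>0. \<forall>u\<in>D. \<bar>\<phi> u\<bar> \<le> (C::real)"
proof -
  interpret real_distribution G by fact
  obtain v1 where v1: "v1 \<in> dist_support G" "0 < \<psi> v1"
    using ex_dist_support_pos[OF assms(2,3)] by auto
  have "has_bochner_integral G (\<lambda>v. - \<psi> v) 0"
    using has_bochner_integral_minus[OF assms(2)] by simp
  then obtain v2 where v2: "v2 \<in> dist_support G" "\<psi> v2 < 0"
    using ex_dist_support_pos[of "\<lambda>v. - \<psi> v"] assms(3) by auto
  have "\<bar>\<phi> u\<bar> \<le> max (1 / \<psi> v1) (1 / - \<psi> v2)" if "u \<in> D" for u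
  proof -
    have "- (1 / \<psi> v1) \<le> \<phi> u" "\<phi> u \<le> 1 / - \<psi> v2"
      using nonneg[OF that v1(1)] nonneg[OF that v2(1)] v1(2) v2(2)
      by (auto simp: field_simps)
    then show ?thesis by linarith
  qed
  moreover have "0 \<le> max (1 / \<psi> v1) (1 / - \<psi> v2)"
    using v1(2) by (simp add: le_max_iff_disj)
  ultimately show ?thesis by blast
qed

section \<open>A regularly varying law against a lighter one\<close>

lemma sets_exceeds:
  fixes x :: real
  assumes [measurable]: "B \<in> sets borel"
  shows "{(u, v). v \<in> B \<and> x < u * v} \<in> sets (borel \<Otimes>\<^sub>M borel)"
    and "{(u, v). u \<in> B \<and> x < u * v} \<in> sets (borel \<Otimes>\<^sub>M borel)"
proof -
  have "{z \<in> space (borel \<Otimes>\<^sub>M borel). snd z \<in> B \<and> x < fst z * snd z} \<in> sets (borel \<Otimes>\<^sub>M borel)"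
    by measurable
  then show "{(u, v). v \<in> B \<and> x < u * v} \<in> sets (borel \<Otimes>\<^sub>M borel)"
    by (simp add: space_pair_measure case_prod_beta')
  have "{z \<in> space (borel \<Otimes>\<^sub>M borel). fst z \<in> B \<and> x < fst z * snd z} \<in> sets (borel \<Otimes>\<^sub>M borel)"
    by measurable
  then show "{(u, v). u \<in> B \<and> x < u * v} \<in> sets (borel \<Otimes>\<^sub>M borel)"
    by (simp add: space_pair_measure case_prod_beta')
qed

locale regularly_varying_pair = F: real_distribution F + G: real_distribution G
  for F G :: "real measure" and \<alpha> :: real +
  assumes \<alpha>_pos: "0 < \<alpha>"
    and rv: "0 < y \<Longrightarrow> ((\<lambda>x. surv F (x * y) / surv F x) \<longlongrightarrow> y powr - \<alpha>) at_top"
    and G_nonneg: "AE v in G. 0 \<le> v"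
    and G_light: "surv G \<in> o[at_top](surv F)"
begin

sublocale pair_prob_space F G ..

lemma surv_F_pos: "0 < surv F x"
proof (rule F.eventually_surv_pos_imp_pos)
  have "((\<lambda>x. surv F x / surv F x) \<longlongrightarrow> 1) at_top"
    using rv[of 1] by simp
  then have "\<forall>\<^sub>F x in at_top. 0 < surv F x / surv F x"
    by (rule order_tendstoD) simp
  then show "\<forall>\<^sub>F x in at_top. surv F x \<noteq> 0"
    by eventually_elim auto
qed

lemma rv_quotient:
  assumes "0 < v"
  shows "((\<lambda>x. surv F (x / v) / surv F x) \<longlongrightarrow> v powr \<alpha>) at_top"
  using rv[of "1 / v"] assms by (simp add: powr_divide powr_minus_divide)

lemma eventually_surv_le_scaled:
  assumes "0 < v"
  shows "\<forall>\<^sub>F x in at_top. surv F (x / v) \<le> (v powr \<alpha> + 1) * surv F x"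
  using order_tendstoD(2)[OF rv_quotient[OF assms], of "v powr \<alpha> + 1"]
  by (auto elim!: eventually_mono simp: pos_divide_less_eq[OF surv_F_pos])

text \<open>
  The restriction to positive \<open>v\<close> makes \<open>x < u * v\<close> the half-line \<open>u > x / v\<close>; the same holds with the
  roles of the factors exchanged.
\<close>

lemma emeasure_exceeds_with_snd_in:
  assumes [measurable]: "B \<in> sets borel" and "B \<subseteq> {0<..}"
  shows "emeasure (F \<Otimes>\<^sub>M G) {(u, v). v \<in> B \<and> x < u * v} =
           (\<integral>\<^sup>+v. indicator B v * ennreal (surv F (x / v)) \<partial>G)"
proof -
  have "emeasure F ((\<lambda>u. (u, v)) -` {(u, v). v \<in> B \<and> x < u * v}) =
      indicator B v * ennreal (surv F (x / v))" for v
  proof (cases "v \<in> B")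
    case True
    then have "(\<lambda>u. (u, v)) -` {(u, v). v \<in> B \<and> x < u * v} = {x / v<..}"
      using assms(2) by (auto simp: pos_divide_less_eq)
    then show ?thesis
      using True by (simp add: F.emeasure_eq_measure F.surv_eq_measure)
  qed (auto simp: vimage_def)
  moreover have "{(u, v). v \<in> B \<and> x < u * v} \<in> sets (F \<Otimes>\<^sub>M G)"
    by (simp add: sets_exceeds)
  ultimately show ?thesis
    by (simp add: emeasure_pair_measure_alt2)
qed

lemma emeasure_exceeds_with_fst_in:
  assumes [measurable]: "B \<in> sets borel" and "B \<subseteq> {0<..}"
  shows "emeasure (F \<Otimes>\<^sub>M G) {(u, v). u \<in> B \<and> x < u * v} =
           (\<integral>\<^sup>+u. indicator B u * ennreal (surv G (x / u)) \<partial>F)"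
proof -
  have "emeasure G (Pair u -` {(u, v). u \<in> B \<and> x < u * v}) =
      indicator B u * ennreal (surv G (x / u))" for u
  proof (cases "u \<in> B")
    case True
    then have "Pair u -` {(u, v). u \<in> B \<and> x < u * v} = {x / u<..}"
      using assms(2) by (auto simp: pos_divide_less_eq mult.commute)
    then show ?thesis
      using True by (simp add: G.emeasure_eq_measure G.surv_eq_measure)
  qed (auto simp: vimage_def)
  moreover have "{(u, v). u \<in> B \<and> x < u * v} \<in> sets (F \<Otimes>\<^sub>M G)"
    by (simp add: sets_exceeds)
  ultimately show ?thesis
    by (simp add: G.emeasure_pair_measure_alt)
qed

lemma measure_pair_Times:
  assumes "A \<in> sets borel" "B \<in> sets borel"
  shows "measure (F \<Otimes>\<^sub>M G) (A \<times> B) = measure F A * measure G B"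
  using assms by (simp add: measure_def G.emeasure_pair_measure_Times enn2real_mult)

lemma AE_pairI:
  assumes "AE u in F. P u" "AE v in G. Q v"
  shows "AE z in F \<Otimes>\<^sub>M G. P (fst z) \<and> Q (snd z)"
proof -
  obtain A where A: "\<And>u. u \<notin> A \<Longrightarrow> P u" "A \<in> null_sets F"
    using AE_E3[OF assms(1)] by auto
  obtain B where B: "\<And>v. v \<notin> B \<Longrightarrow> Q v" "B \<in> null_sets G"
    using AE_E3[OF assms(2)] by auto
  have "A \<times> UNIV \<in> null_sets (F \<Otimes>\<^sub>M G)" "UNIV \<times> B \<in> null_sets (F \<Otimes>\<^sub>M G)"
    using A(2) B(2) by (auto simp: null_sets_def G.emeasure_pair_measure_Times intro!: pair_measureI)
  then show ?thesis
    by (intro AE_I'[of "A \<times> UNIV \<union> UNIV \<times> B"]) (auto intro!: A(1) B(1))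
qed

definition large_factor :: "real \<Rightarrow> real \<Rightarrow> real" where
  "large_factor N x = measure (F \<Otimes>\<^sub>M G) {(u, v). N < v \<and> x < u * v}"

text \<open>
  This is the uniform integrability of \<open>v \<mapsto> P[X > x / v] / P[X > x]\<close> under \<open>G\<close> that the product theorem
  rests on, and the only consequence of the three alternative conditions that it uses.
\<close>

definition large_factor_negligible :: bool where
  "large_factor_negligible \<longleftrightarrow>
     (\<forall>\<epsilon>>0. \<exists>N. \<forall>\<^sub>F x in at_top. large_factor N x \<le> \<epsilon> * surv F x)"

lemma sets_large_factor [measurable]: "{(u, v). N < v \<and> x < u * v} \<in> sets (F \<Otimes>\<^sub>M G)"
  using sets_exceeds(1)[of "{N<..}" x] by simp

lemma large_factor_antimono: "N \<le> N' \<Longrightarrow> large_factor N' x \<le> large_factor N x"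
  unfolding large_factor_def by (intro finite_measure_mono sets_large_factor) auto

section \<open>The product under a bounded perturbation of independence\<close>

text \<open>
  Conditionally on \<open>u > z\<close>, the kernel is uniformly close to its limit once \<open>z\<close> is large.
\<close>

lemma kernel_tail_integral:
  assumes [measurable]: "\<phi> \<in> borel_measurable borel" and \<phi>: "integrable F \<phi>" "(\<phi> \<longlongrightarrow> d) at_top"
  shows "((\<lambda>z. (LINT u:{z<..}|F. \<phi> u) / surv F z) \<longlongrightarrow> d) at_top"
proof (rule tendstoI)
  fix \<epsilon> :: real assume \<epsilon>: "0 < \<epsilon>"
  obtain Z where Z: "\<And>u. Z \<le> u \<Longrightarrow> dist (\<phi> u) d < \<epsilon> / 2"
    using tendstoD[OF \<phi>(2), of "\<epsilon> / 2"] \<epsilon> by (auto simp: eventually_at_top_linorder)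
  show "\<forall>\<^sub>F z in at_top. dist ((LINT u:{z<..}|F. \<phi> u) / surv F z) d < \<epsilon>"
    using eventually_ge_at_top[of Z]
  proof eventually_elim
    case (elim z)
    have int: "set_integrable F {z<..} \<phi>" "set_integrable F {z<..} (\<lambda>_. d)"
      "set_integrable F {z<..} (\<lambda>_. \<epsilon> / 2)"
      unfolding set_integrable_def by (intro integrable_mult_indicator \<phi>(1); simp)+
    have const: "(LINT u:{z<..}|F. c) = c * surv F z" for c :: real
      by (simp add: set_lebesgue_integral_def F.surv_eq_measure)
    have "\<bar>(LINT u:{z<..}|F. \<phi> u) - d * surv F z\<bar> = \<bar>LINT u:{z<..}|F. \<phi> u - d\<bar>"
      using int by (simp add: set_integral_diff const)
    also have "\<dots> \<le> (LINT u:{z<..}|F. \<bar>\<phi> u - d\<bar>)"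
      using set_integral_norm_bound[OF set_integral_diff(1)[OF int(1,2)]] by simp
    also have "\<dots> \<le> (LINT u:{z<..}|F. \<epsilon> / 2)"
    proof (rule set_integral_mono)
      show "set_integrable F {z<..} (\<lambda>u. \<bar>\<phi> u - d\<bar>)"
        using set_integrable_abs[OF set_integral_diff(1)[OF int(1,2)]] .
      show "\<bar>\<phi> u - d\<bar> \<le> \<epsilon> / 2" if "u \<in> {z<..}" for u
        using Z[of u] that elim by (simp add: dist_real_def)
    qed (rule int)
    also have "\<dots> < \<epsilon> * surv F z"
      using surv_F_pos[of z] \<epsilon> by (simp add: const)
    finally show ?case
      using surv_F_pos[of z] by (simp add: dist_real_def field_simps abs_less_iff)
  qed
qed

text \<open>
  The exchange of limit and integral. Split at \<open>v = N\<close>: below, monotonicity of the tail of \<open>F\<close> gives the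
  constant majorant \<open>D * (N\<^sup>\<alpha> + 1)\<close>, so the limit may be taken in \<open>x\<close> first; above, the density is
  bounded by \<open>D\<close> and negligibility applies. Then \<open>N\<close> is sent to infinity.
\<close>

lemma perturbed_product_tail:
  fixes \<phi> \<psi> :: "real \<Rightarrow> real"
  assumes [measurable]: "\<phi> \<in> borel_measurable borel" "\<psi> \<in> borel_measurable borel"
    and C: "0 \<le> C" "AE u in F. \<bar>\<phi> u\<bar> \<le> C" "AE v in G. \<bar>\<psi> v\<bar> \<le> C"
    and \<phi>_lim: "(\<phi> \<longlongrightarrow> d) at_top"
    and moment: "integrable G (\<lambda>v. v powr \<alpha>)"
    and negligible: large_factor_negligible
  shows "((\<lambda>x. (LINT z|(F \<Otimes>\<^sub>M G). indicator {x<..} (fst z * snd z) * (1 + \<phi> (fst z) * \<psi> (snd z))) / surv F x)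
            \<longlongrightarrow> (LINT v|G. (1 + d * \<psi> v) * v powr \<alpha>)) at_top"
proof -
  define p where "p = (\<lambda>u v. 1 + \<phi> u * \<psi> v)"
  define D where "D = 1 + C * C"
  define inner where "inner = (\<lambda>x v. LINT u|F. indicator {x<..} (u * v) * p u v)"
  define lim where "lim = (\<lambda>v. (1 + d * \<psi> v) * v powr \<alpha>)"
  have [measurable]: "case_prod p \<in> borel_measurable (borel \<Otimes>\<^sub>M borel)"
    "\<And>v. (\<lambda>u. p u v) \<in> borel_measurable borel"
    unfolding p_def by measurable
  have inner_meas [measurable]: "inner x \<in> borel_measurable borel" for x
    unfolding inner_def by measurable
  have D: "0 < D" using C by (simp add: D_def add_pos_nonneg)
  have p_bound: "\<bar>p u v\<bar> \<le> D" if "\<bar>\<phi> u\<bar> \<le> C" "\<bar>\<psi> v\<bar> \<le> C" for u v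
  proof -
    have "\<bar>\<phi> u * \<psi> v\<bar> \<le> C * C"
      unfolding abs_mult using that by (intro mult_mono) auto
    then show ?thesis by (simp add: p_def D_def abs_le_iff)
  qed
  have \<phi>_int: "integrable F \<phi>"
    by (rule F.integrable_const_bound[where B = C]) (use C in auto)

  have inner_lim: "((\<lambda>x. inner x v / surv F x) \<longlongrightarrow> lim v) at_top" if "0 < v" for v
  proof -
    have "inner x v = surv F (x / v) + \<psi> v * (LINT u:{x / v<..}|F. \<phi> u)" for x
    proof -
      have ind: "indicator {x<..} (u * v) = (indicator {x / v<..} u :: real)" for u
        using that by (simp add: indicator_def pos_divide_less_eq)
      have int: "integrable F (\<lambda>u. indicator {x / v<..} u * \<phi> u)"
        using integrable_mult_indicator[OF _ \<phi>_int, of "{x / v<..}"] by simp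
      have "inner x v = (LINT u|F. indicator {x / v<..} u + \<psi> v * (indicator {x / v<..} u * \<phi> u))"
        unfolding inner_def p_def ind by (intro Bochner_Integration.integral_cong) (auto simp: algebra_simps)
      also have "\<dots> = surv F (x / v) + \<psi> v * (LINT u:{x / v<..}|F. \<phi> u)"
        by (subst Bochner_Integration.integral_add)
          (use int in \<open>auto simp: F.surv_eq_measure set_lebesgue_integral_def\<close>)
      finally show ?thesis .
    qed
    then have eq: "inner x v / surv F x =
        surv F (x / v) / surv F x * (1 + \<psi> v * ((LINT u:{x / v<..}|F. \<phi> u) / surv F (x / v)))" for x
      using surv_F_pos[of x] surv_F_pos[of "x / v"] by (simp add: field_simps)
    have "filterlim (\<lambda>x. x / v) at_top at_top"
      using filterlim_tendsto_pos_mult_at_top[OF tendsto_const[of "inverse v"] _ filterlim_ident] that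
      by (simp add: divide_inverse mult.commute)
    note inner_kernel = filterlim_compose[OF kernel_tail_integral[OF _ \<phi>_int \<phi>_lim] this, simplified]
    have "((\<lambda>x. inner x v / surv F x) \<longlongrightarrow> v powr \<alpha> * (1 + \<psi> v * d)) at_top"
      unfolding eq by (intro tendsto_intros rv_quotient that inner_kernel)
    then show ?thesis by (simp add: lim_def mult.commute)
  qed
  have inner_bound: "\<bar>inner x v\<bar> \<le> D * surv F (x / N)"
    if "0 < x" "0 \<le> v" "v \<le> N" "0 < N" "\<bar>\<psi> v\<bar> \<le> C" for x v N
  proof -
    have "\<bar>inner x v\<bar> \<le> (LINT u|F. \<bar>indicator {x<..} (u * v) * p u v\<bar>)"
      unfolding inner_def by (rule integral_abs_bound)
    also have "\<dots> \<le> (LINT u|F. D * indicator {x / N<..} u)"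
    proof (rule integral_mono_AE)
      have "AE u in F. \<bar>indicator {x<..} (u * v) * p u v\<bar> \<le> D * indicator {x / N<..} u \<and>
          \<bar>indicator {x<..} (u * v) * p u v\<bar> \<le> D"
        using C(2)
      proof eventually_elim
        case (elim u)
        have "x / N < u" if "x < u * v"
        proof -
          have "0 < v" using that \<open>0 < x\<close> \<open>0 \<le> v\<close> by (cases "v = 0") auto
          then have "0 < u" using that \<open>0 < x\<close> by (smt (verit) mult_nonpos_nonneg)
          then have "u * v \<le> u * N" using \<open>v \<le> N\<close> by simp
          then show ?thesis using that \<open>0 < N\<close> by (simp add: pos_divide_less_eq)
        qed
        then show ?case
          using p_bound[OF elim \<open>\<bar>\<psi> v\<bar> \<le> C\<close>] D by (auto simp: indicator_def)
      qed
      then show "AE u in F. \<bar>indicator {x<..} (u * v) * p u v\<bar> \<le> D * indicator {x / N<..} u"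
        and "integrable F (\<lambda>u. \<bar>indicator {x<..} (u * v) * p u v\<bar>)"
        by (auto intro!: F.integrable_const_bound[where B = D])
    qed simp
    also have "\<dots> = D * surv F (x / N)"
      by (simp add: F.surv_eq_measure)
    finally show ?thesis .
  qed
  have lim_meas [measurable]: "lim \<in> borel_measurable borel"
    unfolding lim_def by measurable
  have lim_bound: "AE v in G. \<bar>lim v\<bar> \<le> (1 + \<bar>d\<bar> * C) * v powr \<alpha>"
    using C(3)
  proof eventually_elim
    case (elim v)
    have "\<bar>d * \<psi> v\<bar> \<le> \<bar>d\<bar> * C"
      unfolding abs_mult using elim by (intro mult_left_mono) auto
    then have "\<bar>1 + d * \<psi> v\<bar> \<le> 1 + \<bar>d\<bar> * C" by linarith
    then show ?case by (simp add: lim_def abs_mult mult_right_mono)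
  qed

  define g where "g = (\<lambda>x z. indicator {x<..} (fst z * snd z) * p (fst z) (snd z))"
  have [measurable]: "g x \<in> borel_measurable (borel \<Otimes>\<^sub>M borel)" for x
    unfolding g_def p_def by measurable
  have "AE z in F \<Otimes>\<^sub>M G. \<bar>\<phi> (fst z)\<bar> \<le> C \<and> \<bar>\<psi> (snd z)\<bar> \<le> C"
    by (intro AE_pairI C)
  then have g_bound: "AE z in F \<Otimes>\<^sub>M G. \<bar>g x z\<bar> \<le> D * indicator {x<..} (fst z * snd z)" for x
    by eventually_elim (use D p_bound in \<open>auto simp: g_def indicator_def\<close>)
  have g_int: "integrable (F \<Otimes>\<^sub>M G) (g x)" for x
  proof (rule integrable_const_bound)
    show "AE z in F \<Otimes>\<^sub>M G. norm (g x z) \<le> D"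
      using g_bound[of x]
    proof eventually_elim
      case (elim z)
      also have "D * indicator {x<..} (fst z * snd z) \<le> D"
        using D by (simp add: indicator_def)
      finally show ?case by simp
    qed
  qed measurable
  define small where "small = (\<lambda>N x. LINT z|(F \<Otimes>\<^sub>M G). indicator {..N} (snd z) * g x z)"
  define large where "large = (\<lambda>N x. LINT z|(F \<Otimes>\<^sub>M G). indicator {N<..} (snd z) * g x z)"
  have ind_int: "integrable (F \<Otimes>\<^sub>M G) (\<lambda>z. indicator B (snd z) * g x z)"
    if [measurable]: "B \<in> sets borel" for B x
    by (rule Bochner_Integration.integrable_bound[OF g_int[of x]]) (auto simp: indicator_def)
  have split: "(LINT z|(F \<Otimes>\<^sub>M G). g x z) = small N x + large N x" for N x
  proof -
    have "g x z = indicator {..N} (snd z) * g x z + indicator {N<..} (snd z) * g x z" for z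
      by (simp add: indicator_def)
    then show ?thesis
      unfolding small_def large_def
      using Bochner_Integration.integral_add[OF ind_int[of "{..N}" x] ind_int[of "{N<..}" x]] by simp
  qed
  have large_bound: "\<bar>large N x\<bar> \<le> D * large_factor N x" for N x
  proof -
    have "\<bar>large N x\<bar> \<le> (LINT z|(F \<Otimes>\<^sub>M G). \<bar>indicator {N<..} (snd z) * g x z\<bar>)"
      unfolding large_def by (rule integral_abs_bound)
    also have "\<dots> \<le> (LINT z|(F \<Otimes>\<^sub>M G). D * indicator {(u, v). N < v \<and> x < u * v} z)"
    proof (rule integral_mono_AE)
      show "AE z in F \<Otimes>\<^sub>M G. \<bar>indicator {N<..} (snd z) * g x z\<bar>
          \<le> D * indicator {(u, v). N < v \<and> x < u * v} z"
        using g_bound[of x]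
      proof eventually_elim
        case (elim z)
        then show ?case
          using D by (cases "x < fst z * snd z") (auto simp: indicator_def case_prod_beta')
      qed
      show "integrable (F \<Otimes>\<^sub>M G) (\<lambda>z. \<bar>indicator {N<..} (snd z) * g x z\<bar>)"
        using ind_int[of "{N<..}" x] by simp
      show "integrable (F \<Otimes>\<^sub>M G) (\<lambda>z. D * indicator {(u, v). N < v \<and> x < u * v} z)"
        by (intro integrable_mult_right integrable_real_indicator sets_large_factor) (simp add: emeasure_eq_measure)
    qed
    also have "\<dots> = D * large_factor N x"
      using sets_large_factor[of N x] by (simp add: large_factor_def)
    finally show ?thesis .
  qed
  have small_eq: "small N x = (LINT v|G. indicator {..N} v * inner x v)" for N x
  proof -
    have "small N x = (LINT v|G. LINT u|F. indicator {..N} v * (indicator {x<..} (u * v) * p u v))"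
      unfolding small_def using integral_snd[of "\<lambda>u v. indicator {..N} v * g x (u, v)"] ind_int[of "{..N}" x]
      by (simp add: case_prod_beta' g_def)
    then show ?thesis by (simp add: inner_def)
  qed
  have small_lim: "((\<lambda>x. small N x / surv F x) \<longlongrightarrow> (LINT v|G. indicator {..N} v * lim v)) at_top"
    if "0 < N" for N
  proof -
    have "((\<lambda>x. LINT v|G. indicator {..N} v * (inner x v / surv F x)) \<longlongrightarrow>
        (LINT v|G. indicator {..N} v * lim v)) at_top"
    proof (rule integral_dominated_convergence_at_top)
      show "AE v in G. ((\<lambda>x. indicator {..N} v * (inner x v / surv F x)) \<longlongrightarrow> indicator {..N} v * lim v) at_top"
        using G_nonneg
      proof eventually_elim
        case (elim v)
        show ?case
        proof (cases "v = 0")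
          \<comment> \<open>An atom of \<open>G\<close> at \<open>0\<close> contributes nothing on either side, as \<open>0 powr \<alpha> = 0\<close>.\<close>
          case True
          have "\<forall>\<^sub>F x in at_top. inner x 0 / surv F x = (0::real)"
            using eventually_ge_at_top[of 0] by eventually_elim (simp add: inner_def)
          then have "((\<lambda>x. inner x 0 / surv F x) \<longlongrightarrow> 0) at_top"
            by (simp add: tendsto_eventually)
          then show ?thesis
            using True by (intro tendsto_mult tendsto_const) (simp add: lim_def)
        next
          case False
          with elim show ?thesis
            by (intro tendsto_mult tendsto_const inner_lim) simp
        qed
      qed
      show "\<forall>\<^sub>F x in at_top. AE v in G. norm (indicator {..N} v * (inner x v / surv F x)) \<le> D * (N powr \<alpha> + 1)"
        using eventually_surv_le_scaled[OF that] eventually_gt_at_top[of 0]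
      proof eventually_elim
        case (elim x)
        show ?case
          using G_nonneg C(3)
        proof eventually_elim
          case (elim v)
          have "\<bar>inner x v\<bar> \<le> D * (N powr \<alpha> + 1) * surv F x" if "v \<le> N"
          proof -
            have "\<bar>inner x v\<bar> \<le> D * surv F (x / N)"
              using \<open>0 < x\<close> elim that \<open>0 < N\<close> by (intro inner_bound)
            also have "\<dots> \<le> D * ((N powr \<alpha> + 1) * surv F x)"
              using D \<open>surv F (x / N) \<le> _\<close> by (intro mult_left_mono) auto
            finally show ?thesis by (simp add: mult.assoc)
          qed
          then show ?case
            using D surv_F_pos[of x] by (auto simp: indicator_def pos_divide_le_eq)
        qed
      qed
    qed (simp_all add: measurable_cong_sets[OF G.events_eq_borel refl])
    then show ?thesis by (simp add: small_eq)
  qed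
  have trunc_lim: "((\<lambda>N. LINT v|G. indicator {..N} v * lim v) \<longlongrightarrow> (LINT v|G. lim v)) at_top"
  proof (rule integral_dominated_convergence_at_top)
    show "integrable G (\<lambda>v. (1 + \<bar>d\<bar> * C) * v powr \<alpha>)" using moment by simp
    show "AE v in G. ((\<lambda>N. indicator {..N} v * lim v) \<longlongrightarrow> lim v) at_top"
    proof (rule AE_I2)
      fix v
      have "\<forall>\<^sub>F N in at_top. indicator {..N} v * lim v = lim v"
        using eventually_ge_at_top[of v] by eventually_elim simp
      then show "((\<lambda>N. indicator {..N} v * lim v) \<longlongrightarrow> lim v) at_top"
        by (simp add: tendsto_eventually)
    qed
    show "\<forall>\<^sub>F N in at_top. AE v in G. norm (indicator {..N} v * lim v) \<le> (1 + \<bar>d\<bar> * C) * v powr \<alpha>"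
    proof (rule always_eventually, rule allI)
      fix N :: real
      show "AE v in G. norm (indicator {..N} v * lim v) \<le> (1 + \<bar>d\<bar> * C) * v powr \<alpha>"
        using lim_bound by eventually_elim (use C in \<open>auto simp: indicator_def\<close>)
    qed
  qed (simp_all add: measurable_cong_sets[OF G.events_eq_borel refl])

  have "((\<lambda>x. (LINT z|(F \<Otimes>\<^sub>M G). g x z) / surv F x) \<longlongrightarrow> (LINT v|G. lim v)) at_top"
  proof (rule tendstoI)
    fix \<epsilon> :: real assume \<epsilon>: "0 < \<epsilon>"
    obtain N0 where N0: "\<forall>\<^sub>F x in at_top. large_factor N0 x \<le> \<epsilon> / (4 * D) * surv F x"
      using negligible \<epsilon> D unfolding large_factor_negligible_def
      by (metis divide_pos_pos mult_pos_pos zero_less_numeral)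
    have "\<forall>\<^sub>F N in at_top. dist (LINT v|G. indicator {..N} v * lim v) (LINT v|G. lim v) < \<epsilon> / 3 \<and> max 1 N0 \<le> N"
      using tendstoD[OF trunc_lim, of "\<epsilon> / 3"] \<epsilon> by (simp add: eventually_conj eventually_ge_at_top)
    then obtain N where N: "dist (LINT v|G. indicator {..N} v * lim v) (LINT v|G. lim v) < \<epsilon> / 3" "1 \<le> N" "N0 \<le> N"
      by (auto simp: eventually_at_top_linorder)
    have "\<forall>\<^sub>F x in at_top. dist (small N x / surv F x) (LINT v|G. indicator {..N} v * lim v) < \<epsilon> / 3"
      using small_lim[of N] N(2) \<epsilon> by (intro tendstoD) auto
    with N0 show "\<forall>\<^sub>F x in at_top. dist ((LINT z|(F \<Otimes>\<^sub>M G). g x z) / surv F x) (LINT v|G. lim v) < \<epsilon>"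
    proof eventually_elim
      case (elim x)
      have "\<bar>large N x\<bar> \<le> D * (\<epsilon> / (4 * D) * surv F x)"
        using large_bound[of N x] large_factor_antimono[OF N(3), of x] elim(1) D
        by (meson mult_left_mono less_imp_le order_trans)
      then have "\<bar>large N x / surv F x\<bar> \<le> \<epsilon> / 4"
        using D surv_F_pos[of x] by (simp add: pos_divide_le_eq)
      then show ?case
        using elim(2) N(1) \<epsilon> unfolding split[of x N] add_divide_distrib dist_real_def by linarith
    qed
  qed
  then show ?thesis
    by (simp add: g_def p_def lim_def case_prod_beta')
qed

section \<open>Subexponential densities on the logarithmic scale\<close>

text \<open>
  Integration by parts in the form of an inequality. Since \<open>s \<mapsto> P[X > x e\<^bsup>- s\<^esup>]\<close> increases, its value at
  \<open>s = ln v\<close> is at most its mean over \<open>[ln v, ln v + 1)\<close>. Exchanging the order of integration, each \<open>s\<close>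
  then collects only values \<open>v > e\<^bsup>s - 1\<^esup>\<close>, which brings in the tail of \<open>G\<close>.
\<close>

lemma log_scale_Tonelli_bound:
  fixes c :: real
  assumes "0 < x" "0 < N"
  shows "emeasure (F \<Otimes>\<^sub>M G) {(u, v). v \<in> {N<..c} \<and> x < u * v}
    \<le> (\<integral>\<^sup>+s. indicator {ln N..ln c + 1} s * ennreal (surv F (x * exp (- s)) * surv G (exp (s - 1))) \<partial>lborel)"
proof -
  interpret GL: pair_sigma_finite G lborel ..
  define f where "f = (\<lambda>v s. if N < v \<and> v \<le> c \<and> ln v \<le> s \<and> s < ln v + 1
      then ennreal (surv F (x * exp (- s))) else 0)"
  have [measurable]: "case_prod f \<in> borel_measurable (G \<Otimes>\<^sub>M lborel)"
    unfolding f_def by measurable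
  have "emeasure (F \<Otimes>\<^sub>M G) {(u, v). v \<in> {N<..c} \<and> x < u * v} =
      (\<integral>\<^sup>+v. indicator {N<..c} v * ennreal (surv F (x / v)) \<partial>G)"
    using assms by (intro emeasure_exceeds_with_snd_in) auto
  also have "\<dots> \<le> (\<integral>\<^sup>+v. (\<integral>\<^sup>+s. f v s \<partial>lborel) \<partial>G)"
  proof (rule nn_integral_mono)
    fix v
    show "indicator {N<..c} v * ennreal (surv F (x / v)) \<le> (\<integral>\<^sup>+s. f v s \<partial>lborel)"
    proof (cases "v \<in> {N<..c}")
      case True
      then have "0 < v" using assms by auto
      have "ennreal (surv F (x / v)) = (\<integral>\<^sup>+s. ennreal (surv F (x / v)) * indicator {ln v..<ln v + 1} s \<partial>lborel)"
        by (simp add: nn_integral_cmult)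
      also have "\<dots> \<le> (\<integral>\<^sup>+s. f v s \<partial>lborel)"
      proof (rule nn_integral_mono)
        fix s
        have "surv F (x / v) \<le> surv F (x * exp (- s))" if "ln v \<le> s"
        proof (rule F.surv_antimono)
          have "v \<le> exp s" using that \<open>0 < v\<close> by (metis exp_le_cancel_iff exp_ln)
          then show "x * exp (- s) \<le> x / v"
            using assms \<open>0 < v\<close> by (simp add: exp_minus field_simps)
        qed
        then show "ennreal (surv F (x / v)) * indicator {ln v..<ln v + 1} s \<le> f v s"
          using True by (auto simp: f_def indicator_def ennreal_leI)
      qed
      finally show ?thesis using True by simp
    qed simp
  qed
  also have "\<dots> = (\<integral>\<^sup>+s. (\<integral>\<^sup>+v. f v s \<partial>G) \<partial>lborel)"
    by (rule GL.Fubini'[symmetric]) measurable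
  also have "\<dots> \<le> (\<integral>\<^sup>+s. indicator {ln N..ln c + 1} s *
      ennreal (surv F (x * exp (- s)) * surv G (exp (s - 1))) \<partial>lborel)"
  proof (rule nn_integral_mono)
    fix s
    have "f v s \<le> indicator {ln N..ln c + 1} s * ennreal (surv F (x * exp (- s))) * indicator {exp (s - 1)<..} v"
      for v
    proof (cases "N < v \<and> v \<le> c \<and> ln v \<le> s \<and> s < ln v + 1")
      case True
      then have v: "ln N \<le> ln v" "ln v \<le> ln c" "exp (ln v) = v"
        using assms by auto
      have "exp (s - 1) < v"
        using True v(3) by (metis diff_less_eq exp_less_cancel_iff)
      moreover have "ln N \<le> s" "s \<le> ln c + 1"
        using True v(1,2) by linarith+
      ultimately show ?thesis
        using True by (simp add: f_def)
    qed (auto simp: f_def)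
    then have "(\<integral>\<^sup>+v. f v s \<partial>G) \<le> (\<integral>\<^sup>+v. indicator {ln N..ln c + 1} s *
        ennreal (surv F (x * exp (- s))) * indicator {exp (s - 1)<..} v \<partial>G)"
      by (intro nn_integral_mono)
    also have "\<dots> = indicator {ln N..ln c + 1} s * ennreal (surv F (x * exp (- s)) * surv G (exp (s - 1)))"
      by (subst nn_integral_cmult_indicator)
        (simp_all add: G.emeasure_eq_measure G.surv_eq_measure ennreal_mult mult.assoc F.surv_nonneg)
    finally show "(\<integral>\<^sup>+v. f v s \<partial>G) \<le> indicator {ln N..ln c + 1} s *
        ennreal (surv F (x * exp (- s)) * surv G (exp (s - 1)))" .
  qed
  finally show ?thesis .
qed

text \<open>
  The function \<open>h\<close> carries the slowly varying part of both tails: it dominates that of \<open>G\<close> by \<open>light\<close>, and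
  its ratios dominate those of \<open>F\<close> by \<open>slow\<close>. The integrand of the previous lemma is then bounded by
  \<open>P[X > x] h(t - s) / h(t) h(s)\<close> up to a small factor, and membership of \<open>\<S>\<^sub>d\<close> bounds the
  integral. The hypothesis \<open>shift\<close> absorbs the unit shift of the argument of \<open>G\<close>. Values \<open>v > x / A\<close>,
  for which \<open>slow\<close> says nothing, are so rare that the lightness of \<open>G\<close> alone deals with them.
\<close>

lemma large_factor_negligible_if_class_Sd:
  fixes h :: "real \<Rightarrow> real"
  assumes [measurable]: "h \<in> borel_measurable borel" and Sd: "class_Sd h"
    and shift: "\<forall>\<^sub>F s in at_top. h (s - 1) \<le> C\<^sub>1 * h s"
    and light: "(\<lambda>s. surv G (exp s)) \<in> o[at_top](\<lambda>s. exp (- \<alpha> * s) * h s)"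
    and slow: "\<forall>\<^sub>F t in at_top. \<forall>z\<in>{a..t}.
      exp (\<alpha> * z) * surv F (exp z) \<le> C\<^sub>2 * (exp (\<alpha> * t) * surv F (exp t)) * (h z / h t)"
  shows large_factor_negligible
  unfolding large_factor_negligible_def
proof (intro allI impI)
  fix \<epsilon> :: real assume \<epsilon>: "0 < \<epsilon>"
  define a' where "a' = max a 0"
  \<comment> \<open>For \<open>v \<le> x / A\<close> the unit window above \<open>ln v\<close> ends below \<open>t - a'\<close>; hence the summand \<open>1\<close>.\<close>
  define A where "A = exp (a' + 1)"
  have "0 < A" by (simp add: A_def)
  define conv where "conv = (\<lambda>t. \<integral>\<^sup>+s\<in>{0..t}. ennreal (h (t - s) / h t * h s) \<partial>lborel)"
  define I where "I = (\<integral>\<^sup>+u\<in>{0..}. ennreal (h u) \<partial>lborel)"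
  have h_nonneg: "0 \<le> h s" if "0 \<le> s" for s
    using Sd that by (auto simp: class_Sd_def)
  have h_pos: "\<forall>\<^sub>F s in at_top. 0 < h s"
    using Sd by (auto simp: class_Sd_def)
  have I: "I < \<infinity>" and conv_lim: "(conv \<longlongrightarrow> 2 * I) at_top"
    using Sd unfolding class_Sd_def conv_def I_def by auto
  \<comment> \<open>Any finite number above the limit of \<open>conv\<close> would do.\<close>
  define B where "B = enn2real (2 * I + 1)"
  have "2 * I \<noteq> top" using I by (auto simp: ennreal_mult_eq_top_iff)
  then have B: "ennreal B = 2 * I + 1" "2 * I < 2 * I + 1"
    by (auto simp: B_def ennreal_enn2real_if ennreal_add_eq_top)
  have "0 \<le> B" by (simp add: B_def)
  have conv_bound: "\<forall>\<^sub>F t in at_top. conv t \<le> ennreal B"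
    using order_tendstoD(2)[OF conv_lim B(2)] B(1) by (auto elim!: eventually_mono)
  define D where "D = exp \<alpha> * \<bar>C\<^sub>1\<bar> * \<bar>C\<^sub>2\<bar>"
  have "0 \<le> D" by (simp add: D_def)
  define \<delta> where "\<delta> = \<epsilon> / (2 * (D * B + 1))"
  have \<delta>: "0 < \<delta>" "\<delta> * D * B \<le> \<epsilon> / 2"
  proof -
    have "0 \<le> D * B" using \<open>0 \<le> D\<close> \<open>0 \<le> B\<close> by simp
    then show "0 < \<delta>" "\<delta> * D * B \<le> \<epsilon> / 2"
      using \<epsilon> by (auto simp: \<delta>_def field_simps add_pos_nonneg)
  qed
  have "\<forall>\<^sub>F s in at_top. surv G (exp s) \<le> \<delta> * (exp (- \<alpha> * s) * h s)"
    using landau_o.smallD[OF light \<delta>(1)] h_pos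
    by eventually_elim (auto simp: G.surv_nonneg)
  then have "\<forall>\<^sub>F s in at_top. surv G (exp (s - 1)) \<le> \<delta> * (exp (- \<alpha> * (s - 1)) * h (s - 1))"
    using eventually_compose_filterlim filterlim_tendsto_add_at_top[OF tendsto_const[of "- 1"] filterlim_ident]
    by fastforce
  then have "\<forall>\<^sub>F s in at_top. surv G (exp (s - 1)) \<le> \<delta> * (exp (- \<alpha> * (s - 1)) * h (s - 1))
      \<and> h (s - 1) \<le> C\<^sub>1 * h s \<and> 0 \<le> s"
    using shift eventually_ge_at_top[of 0] by eventually_elim auto
  then obtain S where S: "\<And>s. S \<le> s \<Longrightarrow> surv G (exp (s - 1)) \<le> \<delta> * (exp (- \<alpha> * (s - 1)) * h (s - 1))
      \<and> h (s - 1) \<le> C\<^sub>1 * h s \<and> 0 \<le> s"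
    by (auto simp: eventually_at_top_linorder)
  have G_bound: "surv G (exp (s - 1)) \<le> \<delta> * exp \<alpha> * \<bar>C\<^sub>1\<bar> * (exp (- \<alpha> * s) * h s)" if "S \<le> s" for s
  proof -
    have "h (s - 1) \<le> \<bar>C\<^sub>1\<bar> * h s"
      using S[OF that] h_nonneg[of s] by (smt (verit) mult_right_mono)
    have "surv G (exp (s - 1)) \<le> \<delta> * (exp (- \<alpha> * (s - 1)) * h (s - 1))"
      using S[OF that] by simp
    also have "\<dots> \<le> \<delta> * (exp (- \<alpha> * (s - 1)) * (\<bar>C\<^sub>1\<bar> * h s))"
      using \<delta>(1) \<open>h (s - 1) \<le> \<bar>C\<^sub>1\<bar> * h s\<close> by (intro mult_left_mono) auto
    also have "exp (- \<alpha> * (s - 1)) = exp \<alpha> * exp (- \<alpha> * s)"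
      by (simp add: algebra_simps flip: exp_add)
    finally show ?thesis by (simp add: mult_ac)
  qed
  define N where "N = exp S"
  define W where "W = A powr \<alpha> + 1"
  have "0 < W" by (simp add: W_def add_nonneg_pos)
  define \<eta> where "\<eta> = \<epsilon> / (2 * W)"
  have \<eta>: "0 < \<eta>" "\<eta> * W = \<epsilon> / 2" using \<epsilon> \<open>0 < W\<close> by (auto simp: \<eta>_def)
  have "\<forall>\<^sub>F x in at_top. surv G x \<le> \<eta> * surv F x"
    using landau_o.smallD[OF G_light \<eta>(1)] by (simp add: G.surv_nonneg F.surv_nonneg)
  moreover have "filterlim (\<lambda>x. x / A) at_top at_top"
    using filterlim_tendsto_pos_mult_at_top[OF tendsto_const[of "inverse A"] _ filterlim_ident]
    by (simp add: divide_inverse mult.commute A_def)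
  ultimately have far: "\<forall>\<^sub>F x in at_top. surv G (x / A) \<le> \<eta> * surv F (x / A)"
    by (rule eventually_compose_filterlim)
  have "\<forall>\<^sub>F t in at_top. (\<forall>z\<in>{a..t}. exp (\<alpha> * z) * surv F (exp z)
      \<le> C\<^sub>2 * (exp (\<alpha> * t) * surv F (exp t)) * (h z / h t)) \<and> conv t \<le> ennreal B \<and> 0 < h t"
    using slow conv_bound h_pos by eventually_elim auto
  from eventually_compose_filterlim[OF this ln_at_top] far eventually_surv_le_scaled[OF \<open>0 < A\<close>] eventually_gt_at_top[of 0]
  have "\<forall>\<^sub>F x in at_top. large_factor N x \<le> \<epsilon> * surv F x"
  proof eventually_elim
    case (elim x)
    define t where "t = ln x"
    have x: "x = exp t" using elim by (simp add: t_def)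
    have "surv G (x / A) \<le> \<eta> * surv F (x / A)"
      using elim by simp
    also have "\<dots> \<le> \<eta> * (W * surv F x)"
      using elim \<eta>(1) by (intro mult_left_mono) (auto simp: W_def)
    also have "\<dots> = \<epsilon> / 2 * surv F x"
      by (simp add: \<eta>(2) flip: mult.assoc)
    finally have part1: "surv G (x / A) \<le> \<epsilon> / 2 * surv F x" .
    have lnA: "ln (x / A) + 1 = t - a'"
      by (simp add: x A_def ln_div)
    have "emeasure (F \<Otimes>\<^sub>M G) {(u, v). v \<in> {N<..x / A} \<and> x < u * v}
        \<le> (\<integral>\<^sup>+s. indicator {ln N..ln (x / A) + 1} s *
            ennreal (surv F (x * exp (- s)) * surv G (exp (s - 1))) \<partial>lborel)"
      using elim by (intro log_scale_Tonelli_bound) (auto simp: N_def)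
    also have "\<dots> \<le> (\<integral>\<^sup>+s. ennreal (\<delta> * D * surv F x) *
        (ennreal (h (t - s) / h t * h s) * indicator {0..t} s) \<partial>lborel)"
    proof (rule nn_integral_mono)
      fix s
      show "indicator {ln N..ln (x / A) + 1} s * ennreal (surv F (x * exp (- s)) * surv G (exp (s - 1)))
          \<le> ennreal (\<delta> * D * surv F x) * (ennreal (h (t - s) / h t * h s) * indicator {0..t} s)"
      proof (cases "s \<in> {ln N..ln (x / A) + 1}")
        case True
        then have s: "S \<le> s" "s \<le> t - a'" unfolding lnA by (auto simp: N_def)
        then have s': "0 \<le> s" "s \<le> t" "t - s \<in> {a..t}"
          using S[of s] by (auto simp: a'_def)
        define q where "q = h (t - s) / h t"
        have q: "0 \<le> q" using h_nonneg[of "t - s"] s' elim by (simp add: q_def t_def)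
        have "exp (\<alpha> * (t - s)) * surv F (exp (t - s)) \<le> C\<^sub>2 * (exp (\<alpha> * t) * surv F (exp t)) * q"
          using elim s'(3) unfolding q_def t_def by auto
        also have "\<dots> \<le> \<bar>C\<^sub>2\<bar> * (exp (\<alpha> * t) * surv F (exp t)) * q"
          using q by (intro mult_right_mono) (auto simp: F.surv_nonneg)
        finally have "exp (- \<alpha> * s) * surv F (exp (t - s)) \<le> \<bar>C\<^sub>2\<bar> * surv F x * q"
          by (simp add: x algebra_simps exp_diff exp_minus field_simps)
        then have F_bound: "surv F (x * exp (- s)) * exp (- \<alpha> * s) \<le> \<bar>C\<^sub>2\<bar> * surv F x * q"
          by (simp add: x mult.commute flip: exp_add)
        have "surv F (x * exp (- s)) * surv G (exp (s - 1))
            \<le> surv F (x * exp (- s)) * (\<delta> * exp \<alpha> * \<bar>C\<^sub>1\<bar> * (exp (- \<alpha> * s) * h s))"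
          using G_bound[OF s(1)] by (intro mult_left_mono F.surv_nonneg)
        also have "\<dots> = \<delta> * exp \<alpha> * \<bar>C\<^sub>1\<bar> * h s * (surv F (x * exp (- s)) * exp (- \<alpha> * s))"
          by (simp add: mult_ac)
        also have "\<dots> \<le> \<delta> * exp \<alpha> * \<bar>C\<^sub>1\<bar> * h s * (\<bar>C\<^sub>2\<bar> * surv F x * q)"
          using F_bound \<delta>(1) h_nonneg[OF s'(1)] by (intro mult_left_mono) auto
        also have "\<dots> = (\<delta> * D * surv F x) * (q * h s)"
          by (simp add: D_def mult_ac)
        finally have "ennreal (surv F (x * exp (- s)) * surv G (exp (s - 1)))
            \<le> ennreal ((\<delta> * D * surv F x) * (q * h s))"
          by (rule ennreal_leI)
        also have "\<dots> = ennreal (\<delta> * D * surv F x) * ennreal (q * h s)"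
          using \<delta>(1) \<open>0 \<le> D\<close> q h_nonneg[OF s'(1)] by (intro ennreal_mult) (auto simp: F.surv_nonneg)
        finally show ?thesis using True s' by (simp add: q_def)
      qed simp
    qed
    also have "\<dots> = ennreal (\<delta> * D * surv F x) * conv t"
      unfolding conv_def by (rule nn_integral_cmult) measurable
    also have "\<dots> \<le> ennreal (\<delta> * D * surv F x) * ennreal B"
      using elim by (intro mult_left_mono) (auto simp: t_def)
    also have "\<dots> = ennreal (\<delta> * D * B * surv F x)"
      using \<delta>(1) \<open>0 \<le> D\<close> \<open>0 \<le> B\<close> by (subst ennreal_mult[symmetric]) (auto simp: F.surv_nonneg mult_ac)
    also have "\<dots> \<le> ennreal (\<epsilon> / 2 * surv F x)"
      using \<delta>(2) by (intro ennreal_leI mult_right_mono F.surv_nonneg)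
    finally have part2: "measure (F \<Otimes>\<^sub>M G) {(u, v). v \<in> {N<..x / A} \<and> x < u * v} \<le> \<epsilon> / 2 * surv F x"
      using \<epsilon> by (simp add: emeasure_eq_measure F.surv_nonneg)
    have sets: "{(u, v). v \<in> {N<..x / A} \<and> x < u * v} \<in> sets (F \<Otimes>\<^sub>M G)"
        "UNIV \<times> {x / A<..} \<in> sets (F \<Otimes>\<^sub>M G)"
      using sets_exceeds(1)[of "{N<..x / A}" x] by (simp_all add: pair_measureI)
    have "large_factor N x \<le> measure (F \<Otimes>\<^sub>M G) ({(u, v). v \<in> {N<..x / A} \<and> x < u * v} \<union> UNIV \<times> {x / A<..})"
      unfolding large_factor_def by (intro finite_measure_mono sets.Un sets) auto
    also have "\<dots> \<le> measure (F \<Otimes>\<^sub>M G) {(u, v). v \<in> {N<..x / A} \<and> x < u * v}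
        + measure (F \<Otimes>\<^sub>M G) (UNIV \<times> {x / A<..})"
      by (intro measure_Un_le sets)
    also have "measure (F \<Otimes>\<^sub>M G) (UNIV \<times> {x / A<..}) = surv G (x / A)"
      using F.prob_space by (subst measure_pair_Times) (auto simp: G.surv_eq_measure)
    finally show ?case
      using part1 part2 by (simp add: field_simps)
  qed
  then show "\<exists>N. \<forall>\<^sub>F x in at_top. large_factor N x \<le> \<epsilon> * surv F x" ..
qed

text \<open>
  Here \<open>h\<close> is the slowly varying part of \<open>F\<close> itself, so \<open>slow\<close> is an equality and \<open>light\<close> is the lightness
  of \<open>G\<close> relative to \<open>F\<close>.
\<close>

lemma large_factor_negligible_if_slow_class_Sd:
  fixes \<l> :: "real \<Rightarrow> real"
  defines "\<l> \<equiv> \<lambda>t. exp (\<alpha> * t) * surv F (exp t)"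
  assumes "class_Sd \<l>"
  shows large_factor_negligible
proof (rule large_factor_negligible_if_class_Sd)
  show [measurable]: "\<l> \<in> borel_measurable borel"
    unfolding \<l>_def by measurable
  show "class_Sd \<l>" by fact
  have "\<forall>\<^sub>F s in at_top. surv F (exp s / exp 1) \<le> (exp 1 powr \<alpha> + 1) * surv F (exp s)"
    using eventually_compose_filterlim[OF eventually_surv_le_scaled exp_at_top, of "exp 1"] by simp
  then show "\<forall>\<^sub>F s in at_top. \<l> (s - 1) \<le> (exp 1 powr \<alpha> + 1) * \<l> s"
  proof eventually_elim
    case (elim s)
    have "\<l> (s - 1) \<le> exp (\<alpha> * s) * surv F (exp s / exp 1)"
      using \<alpha>_pos by (simp add: \<l>_def exp_diff F.surv_nonneg mult_right_mono)
    also have "\<dots> \<le> exp (\<alpha> * s) * ((exp 1 powr \<alpha> + 1) * surv F (exp s))"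
      using elim by (intro mult_left_mono) auto
    finally show ?case by (simp add: \<l>_def mult_ac)
  qed
  have "(\<lambda>s. surv G (exp s)) \<in> o[at_top](\<lambda>s. surv F (exp s))"
    using landau_o.small.compose[OF G_light exp_at_top] .
  then show "(\<lambda>s. surv G (exp s)) \<in> o[at_top](\<lambda>s. exp (- \<alpha> * s) * \<l> s)"
    by (simp add: \<l>_def flip: mult.assoc exp_add)
  show "\<forall>\<^sub>F t in at_top. \<forall>z\<in>{0..t}. exp (\<alpha> * z) * surv F (exp z)
      \<le> 1 * (exp (\<alpha> * t) * surv F (exp t)) * (\<l> z / \<l> t)"
    using surv_F_pos by (intro always_eventually) (simp add: \<l>_def order.strict_implies_not_eq[symmetric, OF surv_F_pos])
qed

text \<open>
  The factor \<open>w\<close> stands for \<open>1\<close> in type (iii) and for \<open>x \<mapsto> 1 / P[V > x]\<close> in type (iv). As it increases,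
  \<open>w z / w t \<le> 1\<close> for \<open>z \<le> t\<close>, so the ratios of the slowly varying part of \<open>F\<close> are dominated by those of
  the tail of \<open>U\<close>.
\<close>

lemma large_factor_negligible_if_S_star:
  fixes w :: "real \<Rightarrow> real"
  assumes U: "long_tailed U" "class_S_star U"
    and c: "0 < c0" "(c \<longlongrightarrow> c0) at_top"
    and w: "\<And>x y. x \<le> y \<Longrightarrow> w x \<le> w y" "\<And>x. 0 < w x"
    and rep: "\<And>x. 0 < x \<Longrightarrow> x powr \<alpha> * surv F x = c x * surv U (ln x) * w (ln x)"
    and light: "surv G \<in> o[at_top](\<lambda>x. x powr - \<alpha> * surv U (ln x))"
  shows large_factor_negligible
proof -
  interpret U: real_distribution U
    using U(1) by (simp add: long_tailed_def)
  have U_pos: "0 < surv U x" for x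
    using long_tailed_surv_pos[OF U(1)] .
  have "((\<lambda>s. surv U s / surv U (s + - 1)) \<longlongrightarrow> 1) at_top"
    using U(1) unfolding long_tailed_def tail_equiv_def by blast
  then have "\<forall>\<^sub>F s in at_top. 1 / 2 < surv U s / surv U (s + - 1)"
    by (rule order_tendstoD) simp
  then have shift: "\<forall>\<^sub>F s in at_top. surv U (s - 1) \<le> 2 * surv U s"
    by eventually_elim (use U_pos in \<open>simp add: pos_less_divide_eq\<close>)
  have "(\<lambda>s. surv G (exp s)) \<in> o[at_top](\<lambda>s. exp s powr - \<alpha> * surv U (ln (exp s)))"
    using landau_o.small.compose[OF light exp_at_top] .
  then have light': "(\<lambda>s. surv G (exp s)) \<in> o[at_top](\<lambda>s. exp (- \<alpha> * s) * surv U s)"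
    by (simp add: exp_powr_real mult.commute)
  have "((\<lambda>t. c (exp t)) \<longlongrightarrow> c0) at_top"
    using filterlim_compose[OF c(2) exp_at_top] .
  from order_tendstoD(1)[OF this, of "c0 / 2"] order_tendstoD(2)[OF this, of "2 * c0"]
  have "\<forall>\<^sub>F t in at_top. c0 / 2 < c (exp t) \<and> c (exp t) < 2 * c0"
    using c(1) by (simp add: eventually_conj)
  then obtain a where a: "\<And>t. a \<le> t \<Longrightarrow> c0 / 2 < c (exp t) \<and> c (exp t) < 2 * c0"
    by (auto simp: eventually_at_top_linorder)
  have rep': "exp (\<alpha> * t) * surv F (exp t) = c (exp t) * surv U t * w t" for t
    using rep[of "exp t"] by (simp add: exp_powr_real mult.commute)
  have "\<forall>\<^sub>F t in at_top. \<forall>z\<in>{a..t}. exp (\<alpha> * z) * surv F (exp z)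
      \<le> 4 * (exp (\<alpha> * t) * surv F (exp t)) * (surv U z / surv U t)"
  proof (rule always_eventually, intro allI ballI)
    fix t z assume z: "z \<in> {a..t}"
    have "exp (\<alpha> * z) * surv F (exp z) = c (exp z) * (surv U z * w z)"
      by (simp add: rep' mult.assoc)
    \<comment> \<open>Beyond \<open>a\<close> the function \<open>c\<close> stays within a factor \<open>2\<close> of its limit, whence \<open>4\<close> for a ratio.\<close>
    also have "\<dots> \<le> (2 * c0) * (surv U z * w t)"
      using a[of z] z w U_pos[of z] c(1) w(2)[of z] by (intro mult_mono) (auto simp: less_imp_le)
    also have "\<dots> \<le> (4 * c (exp t)) * (surv U z * w t)"
      using a[of t] z w(2)[of t] U_pos[of z] by (intro mult_right_mono) (auto simp: less_imp_le)
    also have "\<dots> = 4 * (exp (\<alpha> * t) * surv F (exp t)) * (surv U z / surv U t)"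
      using U_pos[of t] by (simp add: rep')
    finally show "exp (\<alpha> * z) * surv F (exp z)
        \<le> 4 * (exp (\<alpha> * t) * surv F (exp t)) * (surv U z / surv U t)" .
  qed
  then show ?thesis
    using U(2) shift light' unfolding class_S_star_def
    by (intro large_factor_negligible_if_class_Sd[where h = "surv U" and C\<^sub>1 = 2 and C\<^sub>2 = 4 and a = a]) auto
qed

section \<open>Infinite moments\<close>

text \<open>
  The mass on \<open>(y / 2, y]\<close> suffices: there \<open>v\<^sup>\<alpha>\<close> is at least \<open>(y / 2)\<^sup>\<alpha>\<close>, and by regular variation
  \<open>P[y / 2 < X \<le> y] \<sim> (2\<^sup>\<alpha> - 1) P[X > y]\<close>.
\<close>

lemma slow_part_le_trunc_moment:
  fixes m :: "real \<Rightarrow> real"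
  defines "m \<equiv> \<lambda>x. LINT v:{0..x}|F. v powr \<alpha>"
  shows "\<exists>C>0. \<forall>\<^sub>F y in at_top. y powr \<alpha> * surv F y \<le> C * m y"
proof -
  define b where "b = 2 powr \<alpha>"
  have b: "1 < b" using \<alpha>_pos by (simp add: b_def)
  \<comment> \<open>The quotient tends to \<open>b > 1\<close>; the midpoint of \<open>1\<close> and \<open>b\<close> leaves room below the limit.\<close>
  have "\<forall>\<^sub>F y in at_top. (1 + b) / 2 < surv F (y / 2) / surv F y"
    using order_tendstoD(1)[OF rv_quotient[of 2], of "(1 + b) / 2"] b by (simp add: b_def)
  then have "\<forall>\<^sub>F y in at_top. y powr \<alpha> * surv F y \<le> 2 * b / (b - 1) * m y"
    using eventually_gt_at_top[of 0]
  proof eventually_elim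
    case (elim y)
    have int: "integrable F (\<lambda>v. indicator {0..y} v * v powr \<alpha>)"
      by (rule F.integrable_const_bound[where B = "y powr \<alpha>"])
        (use \<alpha>_pos in \<open>auto simp: indicator_def intro!: powr_mono2\<close>)
    have "(y / 2) powr \<alpha> * (surv F (y / 2) - surv F y) = (LINT v|F. (y / 2) powr \<alpha> * indicator {y / 2<..y} v)"
    proof -
      have "surv F (y / 2) = measure F {y / 2<..y} + surv F y"
        unfolding F.surv_eq_measure using elim
        by (subst F.finite_measure_Union[symmetric]) (auto intro!: arg_cong[where f = "measure F"])
      then show ?thesis by simp
    qed
    also have "\<dots> \<le> (LINT v|F. indicator {0..y} v * v powr \<alpha>)"
    proof (rule integral_mono)
      show "(y / 2) powr \<alpha> * indicator {y / 2<..y} v \<le> indicator {0..y} v * v powr \<alpha>" for v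
        using elim \<alpha>_pos by (auto simp: indicator_def intro!: powr_mono2)
    qed (simp_all add: int)
    also have "\<dots> = m y"
      by (simp add: m_def set_lebesgue_integral_def)
    finally have 1: "y powr \<alpha> * (surv F (y / 2) - surv F y) \<le> b * m y"
      using elim b by (simp add: powr_divide b_def field_simps)
    have "(b - 1) / 2 * surv F y \<le> surv F (y / 2) - surv F y"
      using elim surv_F_pos[of y] by (simp add: field_simps)
    then have "y powr \<alpha> * ((b - 1) / 2 * surv F y) \<le> y powr \<alpha> * (surv F (y / 2) - surv F y)"
      by (intro mult_left_mono) auto
    with 1 show ?case
      using b by (simp add: field_simps)
  qed
  moreover have "0 < 2 * b / (b - 1)" using b by simp
  ultimately show ?thesis by blast
qed

text \<open>
  The event is covered by four sets, each of probability at most \<open>\<epsilon> / 4 * surv F x\<close>: a moderate second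
  factor (\<open>S1\<close>), a second factor beyond \<open>x\<close> (\<open>S2\<close>), a first factor in \<open>[1, \<surd>x]\<close> (\<open>S3\<close>), and
  both factors beyond \<open>\<surd>x\<close> (\<open>S4\<close>). A first factor below \<open>1\<close> leads to \<open>S1\<close> or \<open>S2\<close>. In \<open>S1\<close> and \<open>S3\<close> the
  bounded factor \<open>w\<close> satisfies \<open>\<surd>x \<le> x / w \<le> x\<close>, the range in which \<open>slow\<close> compares
  \<open>P[X > x / w]\<close> with \<open>w\<^sup>\<alpha> P[X > x]\<close>; integrating \<open>w\<^sup>\<alpha>\<close> gives a tail of the \<open>\<alpha>\<close>-moment of \<open>G\<close>
  in the first case and the truncated moment of \<open>F\<close> in the second.
\<close>

lemma large_factor_negligible_if_infinite_moment:
  fixes m :: "real \<Rightarrow> real"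
  defines "m \<equiv> \<lambda>x. LINT v:{0..x}|F. v powr \<alpha>"
  assumes moment: "integrable G (\<lambda>v. v powr \<alpha>)"
    and m_lim: "filterlim m at_top at_top"
    and light: "surv G \<in> o[at_top](\<lambda>x. surv F x / m x)"
    and slow: "\<forall>\<^sub>F x in at_top. \<forall>y\<in>{sqrt x..x}. y powr \<alpha> * surv F y \<le> C * (x powr \<alpha> * surv F x)"
  shows large_factor_negligible
  unfolding large_factor_negligible_def
proof (intro allI impI)
  fix \<epsilon> :: real assume \<epsilon>: "0 < \<epsilon>"
  obtain C' where C': "0 < C'" "\<forall>\<^sub>F y in at_top. y powr \<alpha> * surv F y \<le> C' * m y"
    using slow_part_le_trunc_moment unfolding m_def by blast
  define D where "D = \<bar>C\<bar> + 1"
  have D: "0 < D" "\<bar>C\<bar> \<le> D" by (auto simp: D_def)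
  define \<tau> where "\<tau> = (\<lambda>N. LINT v|G. indicator {N<..} v * v powr \<alpha>)"
  have \<tau>_int: "integrable G (\<lambda>v. indicator {N<..} v * v powr \<alpha>)" for N
    using integrable_mult_indicator[OF _ moment, of "{N<..}"] by simp
  have "(\<tau> \<longlongrightarrow> (LINT v|G. 0)) at_top"
    unfolding \<tau>_def
  proof (rule integral_dominated_convergence_at_top)
    show "AE v in G. ((\<lambda>N. indicator {N<..} v * v powr \<alpha>) \<longlongrightarrow> 0) at_top"
    proof (rule AE_I2)
      fix v :: real
      have "\<forall>\<^sub>F N in at_top. indicator {N<..} v * v powr \<alpha> = 0"
        using eventually_ge_at_top[of v] by eventually_elim simp
      then show "((\<lambda>N. indicator {N<..} v * v powr \<alpha>) \<longlongrightarrow> 0) at_top"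
        by (simp add: tendsto_eventually)
    qed
    show "\<forall>\<^sub>F N in at_top. AE v in G. norm (indicator {N<..} v * v powr \<alpha>) \<le> v powr \<alpha>"
      by (intro always_eventually allI AE_I2) (auto simp: indicator_def)
  qed (use moment in simp_all)
  then have "\<forall>\<^sub>F N in at_top. \<tau> N < \<epsilon> / (4 * D) \<and> 1 \<le> N"
    using order_tendstoD(2)[of \<tau> 0 at_top "\<epsilon> / (4 * D)"] \<epsilon> D by (simp add: eventually_conj eventually_ge_at_top)
  then obtain N where N: "\<tau> N < \<epsilon> / (4 * D)" "1 \<le> N"
    by (auto simp: eventually_at_top_linorder)
  define \<delta> where "\<delta> = \<epsilon> / (4 * D * max 1 C')"
  have \<delta>: "0 < \<delta>" "\<delta> * D \<le> \<epsilon> / 4" "\<delta> * D * C' \<le> \<epsilon> / 4"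
    using \<epsilon> D C'(1) by (auto simp: \<delta>_def field_simps max_def)

  have sqrt_lim: "filterlim sqrt at_top at_top" by (rule sqrt_at_top)
  have m_int: "integrable F (\<lambda>u. indicator {0..z} u * u powr \<alpha>)" for z
    by (rule F.integrable_const_bound[where B = "z powr \<alpha>"])
      (use \<alpha>_pos in \<open>auto simp: indicator_def intro!: powr_mono2\<close>)
  have m_mono: "m x \<le> m y" if "x \<le> y" for x y
    unfolding m_def set_lebesgue_integral_def real_scaleR_def
    by (intro integral_mono m_int) (use that in \<open>auto simp: indicator_def\<close>)
  have "\<forall>\<^sub>F y in at_top. surv G y \<le> \<delta> * (surv F y / m y) \<and> 0 < m y \<and> y powr \<alpha> * surv F y \<le> C' * m y"
    using landau_o.smallD[OF light \<delta>(1)] filterlim_at_top_dense[THEN iffD1, OF m_lim, rule_format, of 0] C'(2)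
    by eventually_elim (auto simp: G.surv_nonneg F.surv_nonneg)
  then obtain Z where Z: "\<And>y. Z \<le> y \<Longrightarrow> surv G y \<le> \<delta> * (surv F y / m y)"
    "\<And>y. Z \<le> y \<Longrightarrow> 0 < m y" "\<And>y. Z \<le> y \<Longrightarrow> y powr \<alpha> * surv F y \<le> C' * m y"
    by (auto simp: eventually_at_top_linorder)
  have "\<forall>\<^sub>F x in at_top. surv G x \<le> \<epsilon> / 4 * surv F x"
    using landau_o.smallD[OF G_light, of "\<epsilon> / 4"] \<epsilon> by (simp add: G.surv_nonneg F.surv_nonneg)
  moreover have "\<forall>\<^sub>F x in at_top. Z \<le> sqrt x"
    using sqrt_lim by (simp add: filterlim_at_top)
  ultimately have "\<forall>\<^sub>F x in at_top. large_factor N x \<le> \<epsilon> * surv F x"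
    using slow eventually_ge_at_top[of 1]
  proof eventually_elim
    case (elim x)
    let ?P = "F \<Otimes>\<^sub>M G"
    have x: "0 < sqrt x" "1 \<le> sqrt x" "sqrt x * sqrt x = x"
      using elim by auto
    have slow_x: "surv F (x / w) \<le> D * (w powr \<alpha> * surv F x)" if w: "1 \<le> w" "w \<le> sqrt x" for w
    proof -
      have "x / w \<in> {sqrt x..x}"
      proof -
        have "sqrt x * w \<le> sqrt x * sqrt x" using w x by (intro mult_left_mono) auto
        then have "sqrt x \<le> x / w" using w x(3) by (simp add: pos_le_divide_eq)
        moreover have "x / w \<le> x" using w elim by (simp add: divide_le_eq)
        ultimately show ?thesis by simp
      qed
      then have "(x / w) powr \<alpha> * surv F (x / w) \<le> C * (x powr \<alpha> * surv F x)"
        using elim by blast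
      also have "\<dots> \<le> D * (x powr \<alpha> * surv F x)"
        using D by (intro mult_right_mono) (auto simp: F.surv_nonneg)
      finally show ?thesis
        using w elim by (simp add: powr_divide field_simps)
    qed
    define S1 where "S1 = {(u, v). v \<in> {N<..sqrt x} \<and> x < u * v}"
    define S2 where "S2 = (UNIV :: real set) \<times> {x<..}"
    define S3 where "S3 = {(u, v). u \<in> {1..sqrt x} \<and> x < u * v}"
    define S4 where "S4 = {sqrt x<..} \<times> {sqrt x<..}"
    have sets [simp]: "S1 \<in> sets ?P" "S2 \<in> sets ?P" "S3 \<in> sets ?P" "S4 \<in> sets ?P"
      using sets_exceeds(1)[of "{N<..sqrt x}" x] sets_exceeds(2)[of "{1..sqrt x}" x]
      unfolding S1_def S2_def S3_def S4_def by (simp_all add: pair_measureI)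

    have "emeasure ?P S1 = (\<integral>\<^sup>+v. indicator {N<..sqrt x} v * ennreal (surv F (x / v)) \<partial>G)"
      unfolding S1_def using N by (intro emeasure_exceeds_with_snd_in) auto
    also have "\<dots> \<le> (\<integral>\<^sup>+v. ennreal (D * surv F x) * ennreal (indicator {N<..} v * v powr \<alpha>) \<partial>G)"
    proof (rule nn_integral_mono)
      fix v
      show "indicator {N<..sqrt x} v * ennreal (surv F (x / v))
          \<le> ennreal (D * surv F x) * ennreal (indicator {N<..} v * v powr \<alpha>)"
      proof (cases "v \<in> {N<..sqrt x}")
        case True
        then have "surv F (x / v) \<le> (D * surv F x) * v powr \<alpha>"
          using slow_x[of v] N by (simp add: mult_ac)
        then have "ennreal (surv F (x / v)) \<le> ennreal (D * surv F x) * ennreal (v powr \<alpha>)"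
          using D by (subst ennreal_mult[symmetric]) (auto simp: F.surv_nonneg intro!: ennreal_leI)
        then show ?thesis using True by simp
      qed simp
    qed
    also have "\<dots> = ennreal (D * surv F x) * ennreal (\<tau> N)"
      unfolding \<tau>_def using \<tau>_int[of N]
      by (subst nn_integral_cmult) (auto simp: nn_integral_eq_integral)
    also have "\<dots> \<le> ennreal (D * surv F x) * ennreal (\<epsilon> / (4 * D))"
      using N(1) by (intro mult_left_mono ennreal_leI) auto
    also have "\<dots> = ennreal (\<epsilon> / 4 * surv F x)"
      using D \<epsilon> by (subst ennreal_mult[symmetric]) (auto simp: F.surv_nonneg field_simps)
    finally have S1: "measure ?P S1 \<le> \<epsilon> / 4 * surv F x"
      using \<epsilon> by (simp add: emeasure_eq_measure F.surv_nonneg)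

    have S2: "measure ?P S2 \<le> \<epsilon> / 4 * surv F x"
      unfolding S2_def using elim F.prob_space by (subst measure_pair_Times) (auto simp: G.surv_eq_measure)

    define k where "k = \<delta> * D * surv F x / m (sqrt x)"
    have m_pos: "0 < m (sqrt x)" using Z(2) elim by simp
    have k: "0 \<le> k" using \<delta>(1) D m_pos by (simp add: k_def F.surv_nonneg)
    have "emeasure ?P S3 = (\<integral>\<^sup>+u. indicator {1..sqrt x} u * ennreal (surv G (x / u)) \<partial>F)"
      unfolding S3_def by (intro emeasure_exceeds_with_fst_in) auto
    also have "\<dots> \<le> (\<integral>\<^sup>+u. ennreal k * ennreal (indicator {0..sqrt x} u * u powr \<alpha>) \<partial>F)"
    proof (rule nn_integral_mono)
      fix u
      show "indicator {1..sqrt x} u * ennreal (surv G (x / u))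
          \<le> ennreal k * ennreal (indicator {0..sqrt x} u * u powr \<alpha>)"
      proof (cases "u \<in> {1..sqrt x}")
        case True
        then have "sqrt x * u \<le> sqrt x * sqrt x" using x by (intro mult_left_mono) auto
        then have "sqrt x \<le> x / u" using True x(3) by (simp add: pos_le_divide_eq)
        then have "surv G (x / u) \<le> \<delta> * (surv F (x / u) / m (x / u))"
          and "m (sqrt x) \<le> m (x / u)"
          using Z(1) m_mono elim by auto
        moreover have "surv F (x / u) / m (x / u) \<le> D * (u powr \<alpha> * surv F x) / m (sqrt x)"
          using slow_x[of u] True m_pos \<open>m (sqrt x) \<le> m (x / u)\<close> D
          by (intro frac_le) (auto simp: F.surv_nonneg)
        ultimately have "surv G (x / u) \<le> \<delta> * (D * (u powr \<alpha> * surv F x) / m (sqrt x))"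
          using \<delta>(1) by (smt (verit) mult_left_mono)
        also have "\<dots> = k * u powr \<alpha>" by (simp add: k_def)
        finally have "ennreal (surv G (x / u)) \<le> ennreal k * ennreal (u powr \<alpha>)"
          using k by (subst ennreal_mult[symmetric]) (auto intro!: ennreal_leI)
        then show ?thesis using True by simp
      qed simp
    qed
    also have "\<dots> = ennreal k * ennreal (m (sqrt x))"
      unfolding m_def set_lebesgue_integral_def using m_int[of "sqrt x"]
      by (subst nn_integral_cmult) (auto simp: nn_integral_eq_integral)
    also have "\<dots> = ennreal (\<delta> * D * surv F x)"
      using k m_pos by (subst ennreal_mult[symmetric]) (auto simp: k_def)
    also have "\<dots> \<le> ennreal (\<epsilon> / 4 * surv F x)"
      using \<delta>(2) by (intro ennreal_leI mult_right_mono F.surv_nonneg)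
    finally have S3: "measure ?P S3 \<le> \<epsilon> / 4 * surv F x"
      using \<epsilon> by (simp add: emeasure_eq_measure F.surv_nonneg)

    have "measure ?P S4 = surv F (sqrt x) * surv G (sqrt x)"
      unfolding S4_def by (subst measure_pair_Times) (auto simp: F.surv_eq_measure G.surv_eq_measure)
    also have "\<dots> \<le> (D * (sqrt x powr \<alpha> * surv F x)) * (\<delta> * (surv F (sqrt x) / m (sqrt x)))"
    proof (intro mult_mono)
      have "x / sqrt x = sqrt x" using x by (simp add: field_simps)
      then show "surv F (sqrt x) \<le> D * (sqrt x powr \<alpha> * surv F x)"
        using slow_x[of "sqrt x"] x by simp
      show "surv G (sqrt x) \<le> \<delta> * (surv F (sqrt x) / m (sqrt x))"
        using Z(1) elim by simp
    qed (use D in \<open>auto simp: F.surv_nonneg G.surv_nonneg\<close>)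
    also have "\<dots> = (\<delta> * D * surv F x) * ((sqrt x powr \<alpha> * surv F (sqrt x)) / m (sqrt x))"
      by simp
    also have "\<dots> \<le> (\<delta> * D * surv F x) * C'"
      using Z(3)[of "sqrt x"] elim m_pos \<delta>(1) D
      by (intro mult_left_mono) (auto simp: pos_divide_le_eq F.surv_nonneg)
    also have "\<dots> = (\<delta> * D * C') * surv F x" by simp
    also have "\<dots> \<le> \<epsilon> / 4 * surv F x"
      using \<delta>(3) by (intro mult_right_mono F.surv_nonneg)
    finally have S4: "measure ?P S4 \<le> \<epsilon> / 4 * surv F x" .

    have "{(u, v). N < v \<and> x < u * v} \<subseteq> S1 \<union> S2 \<union> (S3 \<union> S4)"
    proof (intro subsetI, rule ccontr)
      fix z assume "z \<in> {(u, v). N < v \<and> x < u * v}" and notin: "z \<notin> S1 \<union> S2 \<union> (S3 \<union> S4)"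
      then obtain u v where z: "z = (u, v)" and uv: "N < v" "x < u * v" by auto
      have "sqrt x < v" "v \<le> x" "u < 1"
        using notin uv by (auto simp: z S1_def S2_def S3_def S4_def not_less not_le)
      then have "u * v < 1 * v" using less_trans[OF x(1), of v] by simp
      with uv \<open>v \<le> x\<close> show False by simp
    qed
    then have "large_factor N x \<le> measure ?P (S1 \<union> S2 \<union> (S3 \<union> S4))"
      unfolding large_factor_def by (intro finite_measure_mono sets.Un sets)
    also have "\<dots> \<le> (measure ?P S1 + measure ?P S2) + (measure ?P S3 + measure ?P S4)"
      by (intro order_trans[OF measure_Un_le] add_mono measure_Un_le sets.Un sets)
    finally show ?case using S1 S2 S3 S4 by simp
  qed
  then show "\<exists>N. \<forall>\<^sub>F x in at_top. large_factor N x \<le> \<epsilon> * surv F x" ..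
qed

end

section \<open>Products of Sarmanov pairs\<close>

theorem theorem2p5:
  fixes M :: "'a measure" and X Y :: "'a \<Rightarrow> real" and \<phi>1 \<phi>2 :: "real \<Rightarrow> real"
    and \<alpha> \<theta> d1 :: real
  assumes "prob_space M"
    and "\<alpha> > 0"
    and "sarmanov M X Y \<phi>1 \<phi>2 \<theta>"
    and "AE \<omega> in M. 0 \<le> X \<omega>"
    and "regularly_varying M X \<alpha>"
    and "integrable M (\<lambda>\<omega>. Y \<omega> powr \<alpha>)"
    and "tail M Y \<in> o[at_top](tail M X)"
    and "(\<phi>1 \<longlongrightarrow> d1) at_top"
    and "DZ2 M X \<alpha> \<or> DZ3 M X Y \<alpha> \<or> DZ4 M X Y \<alpha>"
  shows "let K = (LINT \<omega>|M. Y \<omega> powr \<alpha>) + \<theta> * d1 * (LINT \<omega>|M. \<phi>2 (Y \<omega>) * Y \<omega> powr \<alpha>)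
    in (K \<noteq> 0 \<longrightarrow> tail_equiv (tail M (\<lambda>\<omega>. X \<omega> * Y \<omega>)) (\<lambda>x. K * tail M X x)) \<and>
       (K = 0 \<longrightarrow> tail M (\<lambda>\<omega>. X \<omega> * Y \<omega>) \<in> o[at_top](tail M X))"
proof -
  interpret prob_space M by fact
  have [measurable]: "X \<in> borel_measurable M" "Y \<in> borel_measurable M"
      "\<phi>1 \<in> borel_measurable borel" "\<phi>2 \<in> borel_measurable borel"
    and Y_nonneg: "AE \<omega> in M. 0 \<le> Y \<omega>"
    and centred: "has_bochner_integral M (\<lambda>\<omega>. \<phi>1 (X \<omega>)) 0" "has_bochner_integral M (\<lambda>\<omega>. \<phi>2 (Y \<omega>)) 0"
    and dens_nonneg: "\<And>x y. x \<in> dist_support (distr M borel X) \<Longrightarrow>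
        y \<in> dist_support (distr M borel Y) \<Longrightarrow> 0 \<le> 1 + \<theta> * \<phi>1 x * \<phi>2 y"
    and joint: "distr M (borel \<Otimes>\<^sub>M borel) (\<lambda>\<omega>. (X \<omega>, Y \<omega>)) =
       density (distr M borel X \<Otimes>\<^sub>M distr M borel Y) (\<lambda>(x, y). ennreal (1 + \<theta> * \<phi>1 x * \<phi>2 y))"
    using assms(3) by (auto simp: sarmanov_def)
  define F where "F = distr M borel X"
  define G where "G = distr M borel Y"
  interpret F: real_distribution F unfolding F_def by simp
  interpret G: real_distribution G unfolding G_def by simp
  have survF: "surv F = tail M X" and survG: "surv G = tail M Y"
    by (simp_all add: F_def G_def surv_distr)
  interpret regularly_varying_pair F G \<alpha>
  proof
    show "0 < \<alpha>" by fact
    show "((\<lambda>x. surv F (x * y) / surv F x) \<longlongrightarrow> y powr - \<alpha>) at_top" if "0 < y" for y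
    proof -
      have "((\<lambda>x. y powr - \<alpha> * (tail M X (x * y) / (y powr - \<alpha> * tail M X x))) \<longlongrightarrow> y powr - \<alpha> * 1) at_top"
        using assms(5) that by (intro tendsto_intros) (auto simp: regularly_varying_def tail_equiv_def)
      then show ?thesis using that by (simp add: survF)
    qed
    show "AE v in G. 0 \<le> v"
      unfolding G_def using Y_nonneg by (subst AE_distr_iff) auto
    show "surv G \<in> o[at_top](surv F)"
      using assms(7) by (simp add: survF survG)
  qed
  have moment: "integrable G (\<lambda>v. v powr \<alpha>)"
    using assms(6) by (simp add: G_def integrable_distr_eq)
  have slow_part: "slow_part M X \<alpha> x = x powr \<alpha> * surv F x" for x
    by (simp add: slow_part_def survF)

  have negligible: large_factor_negligible
    using assms(9)
  proof (elim disjE)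
    assume "DZ2 M X \<alpha>"
    then show ?thesis
      by (intro large_factor_negligible_if_slow_class_Sd)
        (simp add: DZ2_def slow_part exp_powr_real mult.commute)
  next
    assume "DZ3 M X Y \<alpha>"
    then obtain U where U: "type_iii (slow_part M X \<alpha>) U \<or> type_iv (slow_part M X \<alpha>) U"
      "class_S_star U" "surv G \<in> o[at_top](\<lambda>x. x powr - \<alpha> * surv U (ln x))"
      by (auto simp: DZ3_def survG)
    from U(1) show ?thesis
    proof
      assume "type_iii (slow_part M X \<alpha>) U"
      then obtain c c0 where "long_tailed U" "0 < c0" "(c \<longlongrightarrow> c0) at_top"
        "\<And>x. 0 < x \<Longrightarrow> x powr \<alpha> * surv F x = c x * surv U (ln x)"
        by (auto simp: type_iii_def slow_part)
      then show ?thesis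
        using U(2,3) by (intro large_factor_negligible_if_S_star[where w = "\<lambda>_. 1" and U = U and c = c]) auto
    next
      assume "type_iv (slow_part M X \<alpha>) U"
      then obtain V c c0 where V: "long_tailed U" "long_tailed V" "0 < c0" "(c \<longlongrightarrow> c0) at_top"
        "\<And>x. 0 < x \<Longrightarrow> x powr \<alpha> * surv F x = c x * surv U (ln x) / surv V (ln x)"
        by (auto simp: type_iv_def slow_part)
      then have "1 / surv V x \<le> 1 / surv V y" if "x \<le> y" for x y
        using real_distribution.surv_antimono[of V x y] long_tailed_surv_pos[of V] that
        by (intro divide_left_mono) (auto simp: long_tailed_def)
      then show ?thesis
        using U(2,3) V long_tailed_surv_pos[OF V(2)]
        by (intro large_factor_negligible_if_S_star[where w = "\<lambda>x. 1 / surv V x" and U = U and c = c]) auto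
    qed
  next
    assume DZ4: "DZ4 M X Y \<alpha>"
    then obtain C :: nat where "Limsup at_top (\<lambda>x. SUP y\<in>{sqrt x..x}.
        ereal (slow_part M X \<alpha> y / slow_part M X \<alpha> x)) < ereal (real C)"
      using less_PInf_Ex_of_nat by (auto simp: DZ4_def)
    then have "\<forall>\<^sub>F x in at_top. (SUP y\<in>{sqrt x..x}.
        ereal (slow_part M X \<alpha> y / slow_part M X \<alpha> x)) < ereal (real C)"
      by (rule Limsup_lessD)
    then have "\<forall>\<^sub>F x in at_top. \<forall>y\<in>{sqrt x..x}. y powr \<alpha> * surv F y \<le> real C * (x powr \<alpha> * surv F x)"
      using eventually_gt_at_top[of 0]
    proof eventually_elim
      case (elim x)
      show ?case
      proof
        fix y assume "y \<in> {sqrt x..x}"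
        then have "ereal (slow_part M X \<alpha> y / slow_part M X \<alpha> x) < ereal (real C)"
          using elim(1) by (meson SUP_upper order_le_less_trans)
        then show "y powr \<alpha> * surv F y \<le> real C * (x powr \<alpha> * surv F x)"
          using elim(2) surv_F_pos[of x] by (simp add: slow_part pos_divide_less_eq)
      qed
    qed
    moreover have "trunc_moment M X \<alpha> = (\<lambda>x. LINT v:{0..x}|F. v powr \<alpha>)"
      by (simp add: trunc_moment_def fun_eq_iff F_def)
    ultimately show ?thesis
      using DZ4 moment by (intro large_factor_negligible_if_infinite_moment) (auto simp: DZ4_def survF survG)
  qed

  define p where "p = (\<lambda>z. 1 + \<theta> * \<phi>1 (fst z) * \<phi>2 (snd z))"
  define K where "K = (LINT \<omega>|M. Y \<omega> powr \<alpha>) + \<theta> * d1 * (LINT \<omega>|M. \<phi>2 (Y \<omega>) * Y \<omega> powr \<alpha>)"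
  have K_eq: "K = (LINT v|G. v powr \<alpha>) + \<theta> * d1 * (LINT v|G. \<phi>2 v * v powr \<alpha>)"
    by (simp add: K_def G_def integral_distr)
  have [measurable]: "p \<in> borel_measurable (borel \<Otimes>\<^sub>M borel)"
    unfolding p_def by measurable
  have "AE z in F \<Otimes>\<^sub>M G. fst z \<in> dist_support F \<and> snd z \<in> dist_support G"
    by (intro AE_pairI F.AE_dist_support G.AE_dist_support)
  then have p_nonneg: "AE z in F \<Otimes>\<^sub>M G. 0 \<le> p z"
    by eventually_elim (use dens_nonneg in \<open>auto simp: p_def F_def G_def\<close>)
  have tail_eq: "tail M (\<lambda>\<omega>. X \<omega> * Y \<omega>) x = (LINT z|(F \<Otimes>\<^sub>M G). indicator {x<..} (fst z * snd z) * p z)" for x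
  proof -
    let ?J = "distr M (borel \<Otimes>\<^sub>M borel) (\<lambda>\<omega>. (X \<omega>, Y \<omega>))"
    have "tail M (\<lambda>\<omega>. X \<omega> * Y \<omega>) x = (LINT \<omega>|M. indicator {x<..} (X \<omega> * Y \<omega>))"
    proof -
      have "(LINT \<omega>|M. indicator {x<..} (X \<omega> * Y \<omega>)) = (LINT \<omega>|M. indicator {\<omega> \<in> space M. x < X \<omega> * Y \<omega>} \<omega> :: real)"
        by (intro Bochner_Integration.integral_cong) (auto simp: indicator_def)
      then show ?thesis by (simp add: tail_def)
    qed
    also have "\<dots> = (LINT z|?J. indicator {x<..} (fst z * snd z))"
      by (subst integral_distr) auto
    also have "?J = density (F \<Otimes>\<^sub>M G) (\<lambda>z. ennreal (p z))"
      by (simp add: joint F_def G_def p_def case_prod_beta')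
    also have "(LINT z|density (F \<Otimes>\<^sub>M G) (\<lambda>z. ennreal (p z)). indicator {x<..} (fst z * snd z)) =
        (LINT z|(F \<Otimes>\<^sub>M G). p z *\<^sub>R (indicator {x<..} (fst z * snd z) :: real))"
      by (rule integral_density) (use p_nonneg in auto)
    finally show ?thesis by (simp add: mult.commute)
  qed

  have hF: "has_bochner_integral F (\<lambda>u. \<theta> * \<phi>1 u) 0" and hG: "has_bochner_integral G \<phi>2 0"
    using centred by (auto simp: has_bochner_integral_iff F_def G_def integrable_distr_eq integral_distr)
  have main: "((\<lambda>x. tail M (\<lambda>\<omega>. X \<omega> * Y \<omega>) x / surv F x) \<longlongrightarrow> K) at_top"
  proof (cases "(AE u in F. \<theta> * \<phi>1 u = 0) \<or> (AE v in G. \<phi>2 v = 0)")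
    case True
    \<comment> \<open>A trivial kernel means independence, which is the case of zero kernels.\<close>
    have "AE z in F \<Otimes>\<^sub>M G. p z = 1"
      using True
    proof
      assume "AE u in F. \<theta> * \<phi>1 u = 0"
      from AE_pairI[of _ "\<lambda>_. True", OF this AE_I2[OF TrueI]] show ?thesis
        by eventually_elim (auto simp: p_def)
    next
      assume "AE v in G. \<phi>2 v = 0"
      from AE_pairI[of "\<lambda>_. True", OF AE_I2[OF TrueI] this] show ?thesis
        by eventually_elim (simp add: p_def)
    qed
    then have "tail M (\<lambda>\<omega>. X \<omega> * Y \<omega>) x = (LINT z|(F \<Otimes>\<^sub>M G). indicator {x<..} (fst z * snd z) * (1 + 0 * 0))" for x
      unfolding tail_eq by (intro integral_cong_AE) auto
    moreover have "K = (LINT v|G. (1 + 0 * 0) * v powr \<alpha>)"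
    proof -
      have "\<theta> * d1 * (LINT v|G. \<phi>2 v * v powr \<alpha>) = 0"
        using True
      proof
        assume 0: "AE u in F. \<theta> * \<phi>1 u = 0"
        \<comment> \<open>As \<open>F\<close> charges every half-line \<open>(z, \<infinity>)\<close>, a kernel vanishing almost surely has limit \<open>0\<close>.\<close>
        have "\<theta> * d1 = 0"
        proof (rule ccontr)
          assume "\<theta> * d1 \<noteq> 0"
          moreover have "((\<lambda>u. \<theta> * \<phi>1 u) \<longlongrightarrow> \<theta> * d1) at_top"
            by (intro tendsto_intros assms)
          ultimately have "\<forall>\<^sub>F u in at_top. \<theta> * \<phi>1 u \<noteq> 0"
            by (metis tendsto_imp_eventually_ne)
          then obtain z where "\<And>u. z \<le> u \<Longrightarrow> \<theta> * \<phi>1 u \<noteq> 0"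
            by (auto simp: eventually_at_top_linorder)
          with 0 have "AE u in F. u \<notin> {z<..}"
            by (auto elim!: eventually_mono)
          then have "F.prob {z<..} = 0"
            by (subst F.prob_eq_0) auto
          then show False
            using surv_F_pos[of z] by (simp add: F.surv_eq_measure)
        qed
        then show ?thesis by simp
      next
        assume "AE v in G. \<phi>2 v = 0"
        then have "(LINT v|G. \<phi>2 v * v powr \<alpha>) = 0"
          by (intro integral_eq_zero_AE) auto
        then show ?thesis by simp
      qed
      then show ?thesis by (simp add: K_eq)
    qed
    ultimately show ?thesis
      using perturbed_product_tail[of "\<lambda>_. 0" "\<lambda>_. 0" 0 0] moment negligible by simp
  next
    case False
    obtain C1 where C1: "0 \<le> C1" "\<And>u. u \<in> dist_support F \<Longrightarrow> \<bar>\<theta> * \<phi>1 u\<bar> \<le> C1"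
      using kernel_bounded_on_support[OF G.real_distribution_axioms hG, of "dist_support F" "\<lambda>u. \<theta> * \<phi>1 u"]
        False dens_nonneg by (auto simp: F_def G_def)
    obtain C2 where C2: "0 \<le> C2" "\<And>v. v \<in> dist_support G \<Longrightarrow> \<bar>\<phi>2 v\<bar> \<le> C2"
      using kernel_bounded_on_support[OF F.real_distribution_axioms hF, of "dist_support G" \<phi>2]
        False dens_nonneg by (auto simp: F_def G_def mult_ac)
    have bounds: "AE u in F. \<bar>\<theta> * \<phi>1 u\<bar> \<le> max C1 C2" "AE v in G. \<bar>\<phi>2 v\<bar> \<le> max C1 C2"
      using F.AE_dist_support G.AE_dist_support C1(2) C2(2)
      by (auto elim!: eventually_mono simp: le_max_iff_disj)
    have "((\<lambda>x. (LINT z|(F \<Otimes>\<^sub>M G). indicator {x<..} (fst z * snd z) * (1 + (\<theta> * \<phi>1 (fst z)) * \<phi>2 (snd z))) / surv F x)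
        \<longlongrightarrow> (LINT v|G. (1 + (\<theta> * d1) * \<phi>2 v) * v powr \<alpha>)) at_top"
      by (rule perturbed_product_tail[OF _ _ _ bounds])
        (use C1(1) moment negligible assms(8) in \<open>auto intro!: tendsto_intros\<close>)
    moreover have "(LINT v|G. (1 + (\<theta> * d1) * \<phi>2 v) * v powr \<alpha>) = K"
    proof -
      have "integrable G (\<lambda>v. max C1 C2 * v powr \<alpha>)" using moment by simp
      then have int: "integrable G (\<lambda>v. \<phi>2 v * v powr \<alpha>)"
        by (rule Bochner_Integration.integrable_bound)
          (use bounds(2) in \<open>auto elim!: eventually_mono simp: abs_mult intro!: mult_right_mono\<close>)
      have "(LINT v|G. (1 + (\<theta> * d1) * \<phi>2 v) * v powr \<alpha>) =
          (LINT v|G. v powr \<alpha> + (\<theta> * d1) * (\<phi>2 v * v powr \<alpha>))"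
        by (simp add: algebra_simps)
      also have "\<dots> = K"
        using int moment by (simp add: K_eq)
      finally show ?thesis .
    qed
    ultimately show ?thesis
      by (simp add: tail_eq p_def)
  qed

  show ?thesis
    unfolding Let_def K_def[symmetric]
  proof (intro conjI impI)
    assume "K \<noteq> 0"
    then have "((\<lambda>x. tail M (\<lambda>\<omega>. X \<omega> * Y \<omega>) x / surv F x / K) \<longlongrightarrow> K / K) at_top"
      by (intro tendsto_intros main)
    with \<open>K \<noteq> 0\<close> show "tail_equiv (tail M (\<lambda>\<omega>. X \<omega> * Y \<omega>)) (\<lambda>x. K * tail M X x)"
      by (simp add: tail_equiv_def survF mult.commute)
  next
    assume "K = 0"
    then show "tail M (\<lambda>\<omega>. X \<omega> * Y \<omega>) \<in> o[at_top](tail M X)"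
      using main surv_F_pos by (intro smalloI_tendsto) (auto simp: survF less_imp_neq[symmetric])
  qed
qed

end
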